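(* Let $G$ be a locally finite Borel bipartite graph on a standard Borel space $V$ which satisfies Hall's condition and is Borel symmetrically tileable. Then $G$ admits a Borel fractional perfect matching.
   Context: $G$ satisfies Hall's condition if $|N(S)|\ge |S|$ for every finite set $S$ of vertices, where $N(S)$ is the set of vertices adjacent to some vertex of $S$. A graph with half-edges is a graph $F$ together with a set $H(F)$ of half-edges and a map $t:H(F)\to V(F)$ assigning to each half-edge the vertex it is incident to; isomorphisms of graphs with half-edges must respect edges, half-edges and incidence. For $S\subseteq V$, $N_{1/2}(S)$ is the graph with half-edges consisting of the induced subgraph $G\upharpoonright S$ together with one half-edge for each edge of $G$ with exactly one endpoint in $S$, incident to that endpoint. For a finite graph with half-edges $F$, $G$ is Borel $F$-tileable if there is a Borel set $\mathcal{T}\subseteq[V]^{<\mathbb{N}}$ (the standard Borel space of finite subsets of $V$) of pairwise disjoint finite $G$-connected sets with $\bigcup\mathcal{T}=V$ and $N_{1/2}(S)\cong F$ for every $S\in\mathcal{T}$. $F$ is half-edge transitive if for any two half-edges $h,h'$ of $F$ there is an automorphism of $F$ mapping $h$ to $h'$. $G$ is Borel symmetrically tileable if it is Borel $F$-tileable for some finite half-edge transitive $F$. A Borel fractional perfect matching is a symmetric Borel function $f:E(G)\to[0,1]$ with $\sum_{e\ni v}f(e)=1$ for every vertex $v$. *)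

theory Defs
  imports "HOL-Analysis.Analysis"
begin

text \<open>A standard Borel space is given as a measure of which only the carrier and the
  \<open>\<sigma>\<close>-algebra matter: the latter is the Borel \<open>\<sigma>\<close>-algebra of some Polish topology on the carrier.\<close>

definition standard_borel_space :: "'a measure \<Rightarrow> bool" where
  "standard_borel_space M \<longleftrightarrow>
     (\<exists>X. completely_metrizable_space X \<and> second_countable X \<and>
          space M = topspace X \<and> sets M = sigma_sets (topspace X) {U. openin X U})"

text \<open>The space of finite subsets of \<open>space M\<close> is the quotient of the disjoint union of the
  powers of \<open>M\<close> under \<open>(x\<^sub>0, \<dots>, x\<^sub>n\<^sub>-\<^sub>1) \<mapsto> {x\<^sub>0, \<dots>, x\<^sub>n\<^sub>-\<^sub>1}\<close>. The generating family
  below is already a \<open>\<sigma>\<close>-algebra, see \<open>sets_finite_subsets_space\<close>.\<close>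

definition finite_subsets_space :: "'a measure \<Rightarrow> 'a set measure" where
  "finite_subsets_space M =
     sigma {S. finite S \<and> S \<subseteq> space M}
       {T. T \<subseteq> {S. finite S \<and> S \<subseteq> space M} \<and>
           (\<forall>n::nat. {x \<in> space (\<Pi>\<^sub>M i\<in>{..<n}. M). x ` {..<n} \<in> T} \<in> sets (\<Pi>\<^sub>M i\<in>{..<n}. M))}"

lemma sets_finite_subsets_space:
  fixes M :: "'a measure"
  shows "sets (finite_subsets_space M) =
     {T. T \<subseteq> {S. finite S \<and> S \<subseteq> space M} \<and>
         (\<forall>n::nat. {x \<in> space (\<Pi>\<^sub>M i\<in>{..<n}. M). x ` {..<n} \<in> T} \<in> sets (\<Pi>\<^sub>M i\<in>{..<n}. M))}"
    (is "_ = ?A")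
proof -
  let ?V = "{S. finite S \<and> S \<subseteq> space M}"
  let ?P = "\<lambda>n::nat. \<Pi>\<^sub>M i\<in>{..<n}. M"
  let ?pre = "\<lambda>n T. {x \<in> space (?P n). x ` {..<n} \<in> T}"
  have V: "x ` {..<n} \<in> ?V" if "x \<in> space (?P n)" for x and n :: nat
    using that by (auto simp: space_PiM)
  have "sigma_algebra ?V ?A"
    unfolding sigma_algebra_iff2
  proof (intro conjI ballI allI impI)
    show "?A \<subseteq> Pow ?V" by blast
    show "{} \<in> ?A" by simp
  next
    fix T assume T: "T \<in> ?A"
    have "?pre n (?V - T) \<in> sets (?P n)" for n
    proof -
      have "?pre n (?V - T) = space (?P n) - ?pre n T"
        using V by blast
      then show ?thesis using T by auto
    qed
    then show "?V - T \<in> ?A" by blast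
  next
    fix T :: "nat \<Rightarrow> 'a set set" assume T: "range T \<subseteq> ?A"
    have "?pre n (\<Union>k. T k) \<in> sets (?P n)" for n
    proof -
      have "?pre n (\<Union>k. T k) = (\<Union>k. ?pre n (T k))" by blast
      moreover have "?pre n (T k) \<in> sets (?P n)" for k using T by blast
      ultimately show ?thesis by auto
    qed
    moreover have "(\<Union>k. T k) \<subseteq> ?V" using T by blast
    ultimately show "(\<Union>k. T k) \<in> ?A" by blast
  qed
  then show ?thesis
    unfolding finite_subsets_space_def by (rule sigma_algebra.sets_measure_of_eq)
qed

text \<open>A graph on \<open>V\<close> is a symmetric irreflexive relation on \<open>V\<close>; each edge appears with both of
  its orientations.\<close>

definition graph_on :: "'a set \<Rightarrow> 'a rel \<Rightarrow> bool" where
  "graph_on V G \<longleftrightarrow> G \<subseteq> V \<times> V \<and> sym G \<and> irrefl G"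

definition borel_graph :: "'a measure \<Rightarrow> 'a rel \<Rightarrow> bool" where
  "borel_graph M G \<longleftrightarrow> graph_on (space M) G \<and> G \<in> sets (M \<Otimes>\<^sub>M M)"

definition locally_finite_graph :: "'a set \<Rightarrow> 'a rel \<Rightarrow> bool" where
  "locally_finite_graph V G \<longleftrightarrow> (\<forall>v\<in>V. finite (G `` {v}))"

text \<open>The two parts of a bipartite Borel graph are not required to be Borel.\<close>

definition bipartite_graph :: "'a set \<Rightarrow> 'a rel \<Rightarrow> bool" where
  "bipartite_graph V G \<longleftrightarrow>
     (\<exists>A B. A \<union> B = V \<and> A \<inter> B = {} \<and> G \<subseteq> A \<times> B \<union> B \<times> A)"

text \<open>The neighbourhood of \<open>S\<close> is \<open>G `` S\<close>, which is finite when \<open>G\<close> is locally finite.\<close>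

definition hall_condition :: "'a set \<Rightarrow> 'a rel \<Rightarrow> bool" where
  "hall_condition V G \<longleftrightarrow> (\<forall>S. S \<subseteq> V \<and> finite S \<longrightarrow> card S \<le> card (G `` S))"

definition connected_in :: "'a rel \<Rightarrow> 'a set \<Rightarrow> bool" where
  "connected_in G S \<longleftrightarrow> (\<forall>x\<in>S. \<forall>y\<in>S. (x, y) \<in> (G \<inter> S \<times> S)\<^sup>*)"

record ('v, 'h) half_edge_graph =
  hverts :: "'v set"
  hedges :: "'v rel"
  halfs :: "'h set"
  incid :: "'h \<Rightarrow> 'v"

definition finite_half_edge_graph :: "('v, 'h) half_edge_graph \<Rightarrow> bool" where
  "finite_half_edge_graph F \<longleftrightarrow>
     graph_on (hverts F) (hedges F) \<and> incid F ` halfs F \<subseteq> hverts F \<and>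
     finite (hverts F) \<and> finite (halfs F)"

definition half_edge_graph_iso ::
  "('v \<Rightarrow> 'w) \<Rightarrow> ('h \<Rightarrow> 'k) \<Rightarrow> ('v, 'h) half_edge_graph \<Rightarrow> ('w, 'k) half_edge_graph \<Rightarrow> bool" where
  "half_edge_graph_iso \<phi> \<psi> F F' \<longleftrightarrow>
     bij_betw \<phi> (hverts F) (hverts F') \<and> bij_betw \<psi> (halfs F) (halfs F') \<and>
     (\<forall>x\<in>hverts F. \<forall>y\<in>hverts F. (x, y) \<in> hedges F \<longleftrightarrow> (\<phi> x, \<phi> y) \<in> hedges F') \<and>
     (\<forall>h\<in>halfs F. incid F' (\<psi> h) = \<phi> (incid F h))"

definition half_edge_graph_isomorphic ::
  "('v, 'h) half_edge_graph \<Rightarrow> ('w, 'k) half_edge_graph \<Rightarrow> bool" where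
  "half_edge_graph_isomorphic F F' \<longleftrightarrow> (\<exists>\<phi> \<psi>. half_edge_graph_iso \<phi> \<psi> F F')"

definition half_edge_transitive :: "('v, 'h) half_edge_graph \<Rightarrow> bool" where
  "half_edge_transitive F \<longleftrightarrow>
     (\<forall>h\<in>halfs F. \<forall>h'\<in>halfs F. \<exists>\<phi> \<psi>. half_edge_graph_iso \<phi> \<psi> F F \<and> \<psi> h = h')"

text \<open>The half-edge coming from an edge with exactly one endpoint in \<open>S\<close> is represented by the
  orientation of that edge which starts in \<open>S\<close>.\<close>

definition half_nbhd :: "'a rel \<Rightarrow> 'a set \<Rightarrow> ('a, 'a \<times> 'a) half_edge_graph" where
  "half_nbhd G S =
     \<lparr>hverts = S, hedges = G \<inter> S \<times> S, halfs = G \<inter> S \<times> (- S), incid = fst\<rparr>"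

definition borel_tileable ::
  "'a measure \<Rightarrow> 'a rel \<Rightarrow> ('v, 'h) half_edge_graph \<Rightarrow> bool" where
  "borel_tileable M G F \<longleftrightarrow>
     (\<exists>\<T> \<in> sets (finite_subsets_space M).
        disjoint \<T> \<and> \<Union>\<T> = space M \<and>
        (\<forall>S\<in>\<T>. connected_in G S \<and> half_edge_graph_isomorphic (half_nbhd G S) F))"

text \<open>Up to isomorphism, every finite graph with half-edges has natural numbers as vertices and
  half-edges.\<close>

definition borel_symmetrically_tileable :: "'a measure \<Rightarrow> 'a rel \<Rightarrow> bool" where
  "borel_symmetrically_tileable M G \<longleftrightarrow>
     (\<exists>F :: (nat, nat) half_edge_graph.
        finite_half_edge_graph F \<and> half_edge_transitive F \<and> borel_tileable M G F)"

text \<open>Used only for locally finite \<open>G\<close>, where the sums are finite.\<close>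

definition borel_fractional_perfect_matching ::
  "'a measure \<Rightarrow> 'a rel \<Rightarrow> ('a \<times> 'a \<Rightarrow> real) \<Rightarrow> bool" where
  "borel_fractional_perfect_matching M G f \<longleftrightarrow>
     f \<in> borel_measurable (restrict_space (M \<Otimes>\<^sub>M M) G) \<and>
     (\<forall>e\<in>G. 0 \<le> f e \<and> f e \<le> 1) \<and>
     (\<forall>(x, y)\<in>G. f (x, y) = f (y, x)) \<and>
     (\<forall>v\<in>space M. (\<Sum>w\<in>G `` {v}. f (v, w)) = 1)"

end

theory Submission imports Defs begin

text \<open>Hall's condition gives an injection \<open>p\<close> from a tile \<open>S\<close> into the vertex set with \<open>p x\<close> adjacent
  to \<open>x\<close>, and suitable weights on the edges \<open>{x, p x}\<close> sum to 1 at every vertex of \<open>S\<close>. Transported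
  to \<open>F\<close> and averaged, they become invariant under the automorphisms of \<open>F\<close>, so half-edge transitivity
  leaves one weight \<open>c\<close> for all half-edges. Hence giving weight \<open>c\<close> to all edges between tiles and
  copying the invariant weights into every tile is consistent, and it does not depend on the
  identifications of the tiles with \<open>F\<close>.

  The resulting function takes finitely many values, and each of its level sets is an image of a
  Borel set of enumerated tiles under a projection. Since the level sets partition \<open>G\<close>, they are
  Borel by Lusin's separation theorem.\<close>

section \<open>Weights from Hall's condition\<close>

text \<open>Hall's condition is used only for subsets of one tile, but with neighbourhoods taken in
  all of \<open>G\<close>: the injection may leave the tile, and the weight then sits on a
  half-edge. The outer endpoint of such an edge needs no attention, because its total comes from its
  own tile, another copy of \<open>F\<close>. The obstacle is agreement: an edge between two tiles
  is a half-edge of both, and the two identifications with \<open>F\<close> may place it at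
  unrelated half-edges.

  The second obstacle is measurability. The identifications come from the axiom of choice, and a
  weight function defined through them has no evident Borel description. Enumerating every tile in
  all possible ways avoids a choice, but several enumerations may yield the same edge: the
  projections need not be injective, so their images are a priori only analytic. Separation needs
  the images for different values to be disjoint, hence all identifications must agree on the weight
  of an edge. This is what the averaging has to deliver.\<close>

theorem hall_marriage:
  fixes A :: "'i \<Rightarrow> 'a set"
  assumes "finite I" and "\<And>i. i \<in> I \<Longrightarrow> finite (A i)"
    and "\<And>J. J \<subseteq> I \<Longrightarrow> card J \<le> card (\<Union> (A ` J))"
  shows "\<exists>p. inj_on p I \<and> (\<forall>i\<in>I. p i \<in> A i)"
  using assms
proof (induction "card I" arbitrary: I A rule: less_induct)
  case less
  note fin = less.prems(1) and finA = less.prems(2) and hall = less.prems(3)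
  have finU: "finite (\<Union> (A ` J))" if "J \<subseteq> I" for J
    using that fin finA by (meson finite_UN finite_subset subsetD)
  \<comment> \<open>The induction of Halmos and Vaughan: a tight set \<open>J\<close> is matched
    within its own neighbourhood, and Hall's condition survives for the other indices; if no proper
    nonempty set is tight, an arbitrary first choice is safe, because removing one element costs
    every set at most one.\<close>
  consider "I = {}"
    | (tight) J where "J \<subset> I" "J \<noteq> {}" "card (\<Union> (A ` J)) = card J"
    | (slack) "I \<noteq> {}" "\<And>J. J \<subset> I \<Longrightarrow> J \<noteq> {} \<Longrightarrow> card J < card (\<Union> (A ` J))"
    by (metis hall le_neq_implies_less psubset_imp_subset)
  then show ?case
  proof cases
    case 1
    then show ?thesis by simp
  next
    case tight
    have finJ: "finite J" using tight(1) fin finite_subset by blast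
    have "\<exists>p. inj_on p J \<and> (\<forall>i\<in>J. p i \<in> A i)"
      using tight fin finA hall finJ
      by (intro less.hyps) (auto intro: psubset_card_mono)
    then obtain p where p: "inj_on p J" "\<forall>i\<in>J. p i \<in> A i" by blast
    let ?U = "\<Union> (A ` J)"
    have "\<exists>q. inj_on q (I - J) \<and> (\<forall>i\<in>I - J. q i \<in> A i - ?U)"
    proof (rule less.hyps)
      show "card (I - J) < card I" using tight fin by (intro psubset_card_mono) auto
      fix K assume K: "K \<subseteq> I - J"
      have finK: "finite K" using K fin finite_subset by blast
      \<comment> \<open>\<open>J\<close> uses up all of \<open>?U\<close>, so a shortage for
        \<open>K\<close> outside \<open>?U\<close> would be a shortage for
        \<open>K \<union> J\<close>.\<close>
      have "card K + card J = card (K \<union> J)"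
        using K finJ finK by (intro card_Un_disjoint[symmetric]) auto
      also have "\<dots> \<le> card (\<Union> (A ` (K \<union> J)))" using K tight by (intro hall) auto
      also have "\<dots> = card (\<Union> (A ` (K \<union> J)) - ?U) + card ?U"
      proof -
        have "finite (\<Union> (A ` (K \<union> J)))" using K tight(1) by (intro finU) auto
        then have "card (\<Union> (A ` (K \<union> J)) - ?U) = card (\<Union> (A ` (K \<union> J))) - card ?U"
          and "card ?U \<le> card (\<Union> (A ` (K \<union> J)))"
          by (auto intro!: card_Diff_subset card_mono intro: finite_subset)
        then show ?thesis by linarith
      qed
      also have "\<Union> (A ` (K \<union> J)) - ?U = (\<Union>i\<in>K. A i - ?U)" by auto
      finally show "card K \<le> card (\<Union>i\<in>K. A i - ?U)" using tight(3) by simp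
    qed (use fin finA in auto)
    then obtain q where q: "inj_on q (I - J)" "\<forall>i\<in>I - J. q i \<in> A i - ?U" by blast
    have "inj_on (\<lambda>i. if i \<in> J then p i else q i) I"
    proof (rule inj_onI)
      have pU: "p i \<in> ?U" if "i \<in> J" for i using that p by blast
      have qU: "q i \<notin> ?U" if "i \<in> I - J" for i using that q by blast
      fix i j assume "i \<in> I" "j \<in> I" and eq: "(if i \<in> J then p i else q i) = (if j \<in> J then p j else q j)"
      then show "i = j"
        using inj_onD[OF p(1), of i j] inj_onD[OF q(1), of i j] pU[of i] pU[of j] qU[of i] qU[of j]
        by (cases "i \<in> J"; cases "j \<in> J") auto
    qed
    then show ?thesis using p q by (intro exI[of _ "\<lambda>i. if i \<in> J then p i else q i"]) auto
  next
    case slack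
    then obtain i where i: "i \<in> I" by blast
    have "card {i} \<le> card (A i)" using hall[of "{i}"] i by simp
    then obtain x where x: "x \<in> A i" by (metis card.empty card_1_singleton_iff equals0I not_one_le_zero One_nat_def)
    have "\<exists>q. inj_on q (I - {i}) \<and> (\<forall>j\<in>I - {i}. q j \<in> A j - {x})"
    proof (rule less.hyps)
      show "card (I - {i}) < card I" using i fin by (meson card_Diff1_less)
      fix K assume K: "K \<subseteq> I - {i}"
      show "card K \<le> card (\<Union>j\<in>K. A j - {x})"
      proof (cases "K = {}")
        case False
        have "K \<subset> I" using K i by auto
        then have "card K \<le> card (\<Union> (A ` K)) - 1" using slack(2)[of K] False by auto
        also have "\<dots> \<le> card (\<Union> (A ` K) - {x})" by (simp add: card_Diff_singleton_if)
        also have "\<Union> (A ` K) - {x} = (\<Union>j\<in>K. A j - {x})" by auto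
        finally show ?thesis .
      qed simp
    qed (use fin finA in auto)
    then obtain q where q: "inj_on q (I - {i})" "\<forall>j\<in>I - {i}. q j \<in> A j - {x}" by blast
    have "inj_on (q(i := x)) I"
      using q by (auto simp: inj_on_def)
    then show ?thesis using q x by (intro exI[of _ "q(i := x)"]) auto
  qed
qed

text \<open>The induction peels off the two-step beginnings of the orbits of \<open>p\<close> that start outside
  \<open>p ` S\<close>, giving them the weights 1 and 0; on the remaining cycles the weight is constantly 1/2.\<close>

lemma orbit_weights:
  fixes p :: "'a \<Rightarrow> 'a"
  assumes "finite S" and "inj_on p S"
  shows "\<exists>w::'a \<Rightarrow> real. (\<forall>x\<in>S. 0 \<le> w x) \<and> (\<forall>x\<in>S. w x + (\<Sum>y | y \<in> S \<and> p y = x. w y) = 1)"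
  using assms
proof (induction "card S" arbitrary: S rule: less_induct)
  case less
  note fin = less.prems(1) and inj = less.prems(2)
  show ?case
  proof (cases "S \<subseteq> p ` S")
    case True
    have "\<exists>y\<in>S. {z. z \<in> S \<and> p z = x} = {y}" if "x \<in> S" for x
    proof -
      obtain y where "y \<in> S" "x = p y" using True \<open>x \<in> S\<close> by blast
      then show ?thesis using inj by (intro bexI[of _ y]) (auto dest: inj_onD)
    qed
    then have "(\<Sum>y | y \<in> S \<and> p y = x. (1/2::real)) = 1/2" if "x \<in> S" for x
      using that by fastforce
    then show ?thesis by (intro exI[of _ "\<lambda>_. 1/2"]) auto
  next
    case False
    then obtain x where x: "x \<in> S" "x \<notin> p ` S" by blast
    \<comment> \<open>\<open>p x\<close> may lie outside \<open>S\<close>; the removal of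
      \<open>x\<close> alone is enough for the induction.\<close>
    define S' where "S' = S - {x, p x}"
    have "card S' < card S" unfolding S'_def using x fin by (intro psubset_card_mono) auto
    moreover have "finite S'" "inj_on p S'" using fin inj by (auto simp: S'_def inj_on_def)
    ultimately obtain w :: "'a \<Rightarrow> real" where w: "\<forall>x\<in>S'. 0 \<le> w x"
      "\<forall>x\<in>S'. w x + (\<Sum>y | y \<in> S' \<and> p y = x. w y) = 1"
      using less.hyps by blast
    define w' where "w' = w(p x := 0, x := 1)"
    have px: "p x \<noteq> x" using x by (metis imageI)
    have "w' z + (\<Sum>y | y \<in> S \<and> p y = z. w' y) = 1" if z: "z \<in> S" for z
    proof -
      consider "z = x" | "z = p x" "z \<noteq> x" | "z \<in> S'" using z by (auto simp: S'_def)
      then show ?thesis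
      proof cases
        case 1
        then have "{y. y \<in> S \<and> p y = z} = {}" using x by auto
        then have "(\<Sum>y | y \<in> S \<and> p y = z. w' y) = 0" by (metis sum.empty)
        then show ?thesis using 1 by (simp add: w'_def)
      next
        case 2
        then have "{y. y \<in> S \<and> p y = z} = {x}" using x inj by (auto dest: inj_onD)
        then have "(\<Sum>y | y \<in> S \<and> p y = z. w' y) = w' x" by simp
        then show ?thesis using 2 by (simp add: w'_def)
      next
        case 3
        \<comment> \<open>Of the two removed points, \<open>x\<close> maps to \<open>p x\<close> and
          not to \<open>z\<close>, while \<open>p x\<close> has weight 0, so neither contributes at
          \<open>z\<close>.\<close>
        have "(\<Sum>y | y \<in> S \<and> p y = z. w' y) = (\<Sum>y | y \<in> S' \<and> p y = z. w' y)"
          using 3 fin by (intro sum.mono_neutral_right) (auto simp: S'_def w'_def)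
        also have "\<dots> = (\<Sum>y | y \<in> S' \<and> p y = z. w y)"
          by (intro sum.cong) (auto simp: S'_def w'_def)
        finally show ?thesis using w 3 by (auto simp: S'_def w'_def)
      qed
    qed
    moreover have "\<forall>z\<in>S. 0 \<le> w' z" using w by (auto simp: S'_def w'_def)
    ultimately show ?thesis by blast
  qed
qed

lemma hall_weights_on_finite_set:
  fixes G :: "'a rel"
  assumes "sym G" and "finite S" and "\<And>x. x \<in> S \<Longrightarrow> finite (G `` {x})"
    and "\<And>K. K \<subseteq> S \<Longrightarrow> card K \<le> card (G `` K)"
  obtains e :: "'a \<Rightarrow> 'a \<Rightarrow> real" where "\<And>x y. 0 \<le> e x y" "\<And>x y. e x y = e y x"
    "\<And>x. x \<in> S \<Longrightarrow> (\<Sum>y\<in>G `` {x}. e x y) = 1"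
proof -
  have "\<exists>p. inj_on p S \<and> (\<forall>x\<in>S. p x \<in> G `` {x})"
    using assms by (intro hall_marriage) (auto simp: Image_eq_UN[symmetric])
  then obtain p where p: "inj_on p S" "\<And>x. x \<in> S \<Longrightarrow> (x, p x) \<in> G" by blast
  obtain w :: "'a \<Rightarrow> real" where w: "\<And>x. x \<in> S \<Longrightarrow> 0 \<le> w x"
    "\<And>x. x \<in> S \<Longrightarrow> w x + (\<Sum>y | y \<in> S \<and> p y = x. w y) = 1"
    using orbit_weights[OF assms(2) p(1)] by blast
  \<comment> \<open>The summands are added because a 2-cycle of \<open>p\<close> puts the weights of
    both its points on the same edge.\<close>
  define e where "e = (\<lambda>x y. (if x \<in> S \<and> p x = y then w x else 0) + (if y \<in> S \<and> p y = x then w y else 0))"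
  show ?thesis
  proof
    show "0 \<le> e x y" for x y using w(1) by (auto simp: e_def)
    show "e x y = e y x" for x y by (simp add: e_def)
    fix x assume x: "x \<in> S"
    have "(\<Sum>y\<in>G `` {x}. e x y)
        = (\<Sum>y\<in>G `` {x}. if p x = y then w x else 0) + (\<Sum>y\<in>G `` {x}. if y \<in> S \<and> p y = x then w y else 0)"
      using x by (simp add: e_def sum.distrib)
    also have "(\<Sum>y\<in>G `` {x}. if p x = y then w x else 0) = w x"
      using x p(2) assms(3) by simp
    \<comment> \<open>Every preimage of \<open>x\<close> under \<open>p\<close> is a neighbour of
      \<open>x\<close> by symmetry of \<open>G\<close>, so no incoming weight is lost.\<close>
    also have "(\<Sum>y\<in>G `` {x}. if y \<in> S \<and> p y = x then w y else 0) = (\<Sum>y | y \<in> S \<and> p y = x. w y)"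
      using assms(2) assms(3)[OF x] p(2) symD[OF assms(1)]
      by (intro sum.mono_neutral_cong_right) (auto split: if_splits)
    finally show "(\<Sum>y\<in>G `` {x}. e x y) = 1" using w(2) x by simp
  qed
qed

section \<open>Lusin's separation theorem\<close>

definition measurably_separable :: "'a measure \<Rightarrow> 'a set \<Rightarrow> 'a set \<Rightarrow> bool" where
  "measurably_separable N P Q \<longleftrightarrow> (\<exists>C\<in>sets N. P \<subseteq> C \<and> Q \<inter> C = {})"

text \<open>For fixed \<open>i\<close>, the intersection of the separators over \<open>j\<close>
  still covers \<open>P i\<close> and misses every \<open>Q j\<close>; the union of these
  intersections over \<open>i\<close> then works.\<close>

lemma measurably_separable_UN:
  assumes "countable I" and "countable J" and "\<And>i. i \<in> I \<Longrightarrow> P i \<subseteq> space N"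
    and "\<And>i j. i \<in> I \<Longrightarrow> j \<in> J \<Longrightarrow> measurably_separable N (P i) (Q j)"
  shows "measurably_separable N (\<Union>i\<in>I. P i) (\<Union>j\<in>J. Q j)"
proof -
  obtain C where C: "\<And>i j. i \<in> I \<Longrightarrow> j \<in> J \<Longrightarrow> C i j \<in> sets N \<and> P i \<subseteq> C i j \<and> Q j \<inter> C i j = {}"
    using assms(4) unfolding measurably_separable_def by metis
  \<comment> \<open>The intersection is written through complements so that an empty
    \<open>J\<close> gives \<open>space N\<close>.\<close>
  let ?C = "\<Union>i\<in>I. space N - (\<Union>j\<in>J. space N - C i j)"
  have "?C \<in> sets N"
    using C by (intro sets.countable_UN'' assms(1,2) sets.Diff sets.top) blast+
  moreover have "P i \<subseteq> space N - (\<Union>j\<in>J. space N - C i j)" if "i \<in> I" for i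
    using assms(3)[OF that] C[OF that] by fast
  then have "(\<Union>i\<in>I. P i) \<subseteq> ?C" by (rule UN_mono[OF subset_refl])
  moreover have "(\<Union>j\<in>J. Q j) \<inter> ?C = {}"
  proof (rule equals0I)
    fix x assume "x \<in> (\<Union>j\<in>J. Q j) \<inter> ?C"
    then obtain i j where "i \<in> I" "j \<in> J" "x \<in> Q j" "x \<in> C i j" by blast
    then show False using C[of i j] by blast
  qed
  ultimately show ?thesis unfolding measurably_separable_def by blast
qed

section \<open>Cylinder sets and separation of images of closed sets\<close>

lemma open_contains_cylinder:
  fixes W :: "(nat \<Rightarrow> nat) set"
  assumes "open W" and "a \<in> W"
  obtains k where "\<And>b. (\<And>i. i < k \<Longrightarrow> b i = a i) \<Longrightarrow> b \<in> W"
proof -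
  have "openin (product_topology (\<lambda>i. euclidean) UNIV) W"
    using assms(1) by (simp add: open_fun_def)
  from product_topology_open_contains_basis[OF this assms(2)]
  obtain X where X: "a \<in> (\<Pi>\<^sub>E i\<in>UNIV. X i)" "finite {i. X i \<noteq> UNIV}" "(\<Pi>\<^sub>E i\<in>UNIV. X i) \<subseteq> W"
    by auto
  obtain k where k: "\<And>i. X i \<noteq> UNIV \<Longrightarrow> i < k"
    using finite_nat_set_iff_bounded[of "{i. X i \<noteq> UNIV}"] X(2) by blast
  have "b \<in> W" if "\<And>i. i < k \<Longrightarrow> b i = a i" for b
  proof -
    have "b i \<in> X i" for i using X(1) k[of i] that[of i] by (cases "X i = UNIV") (auto simp: PiE_iff)
    then show ?thesis using X(3) by (auto simp: PiE_iff)
  qed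
  then show ?thesis using that by blast
qed

lemma closed_cylinder_limit:
  fixes D :: "(nat \<Rightarrow> nat) set"
  assumes "closed D" and "\<And>k. \<exists>b\<in>D. \<forall>i<k. b i = a i"
  shows "a \<in> D"
proof (rule ccontr)
  assume "a \<notin> D"
  then obtain k where "\<And>b. (\<And>i. i < k \<Longrightarrow> b i = a i) \<Longrightarrow> b \<in> - D"
    using open_contains_cylinder[of "- D" a] assms(1) by auto
  then show False using assms(2)[of k] by auto
qed

lemma continuous_on_bool_locally_constant:
  fixes s :: "(nat \<Rightarrow> nat) \<Rightarrow> bool"
  assumes "continuous_on D s" and "a \<in> D"
  obtains k where "\<And>b. b \<in> D \<Longrightarrow> (\<And>i. i < k \<Longrightarrow> b i = a i) \<Longrightarrow> s b = s a"
proof -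
  obtain W where W: "open W" "a \<in> W" "\<And>b. b \<in> D \<Longrightarrow> b \<in> W \<Longrightarrow> s b \<in> {s a}"
    using assms unfolding continuous_on_topological by (metis open_discrete singletonI)
  obtain k where "\<And>b. (\<And>i. i < k \<Longrightarrow> b i = a i) \<Longrightarrow> b \<in> W"
    using open_contains_cylinder[OF W(1,2)] by blast
  then show ?thesis using W(3) that by blast
qed

text \<open>Lusin's argument: if the two images cannot be separated, then neither can the images of some
  pair of arbitrarily small cylinders; these shrink to a pair of points with distinct images,
  which some \<open>U m\<close> separates.\<close>

lemma lusin_separation_clopen:
  fixes D1 D2 :: "(nat \<Rightarrow> nat) set" and U :: "nat \<Rightarrow> 'a set"
  assumes closed: "closed D1" "closed D2"
    and space: "h1 ` D1 \<subseteq> space N" "h2 ` D2 \<subseteq> space N"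
    and U: "\<And>m. U m \<in> sets N"
    and sep: "\<And>x y. x \<in> space N \<Longrightarrow> y \<in> space N \<Longrightarrow> x \<noteq> y \<Longrightarrow> \<exists>m. (x \<in> U m) \<noteq> (y \<in> U m)"
    and cont: "\<And>m. continuous_on D1 (\<lambda>a. h1 a \<in> U m)" "\<And>m. continuous_on D2 (\<lambda>a. h2 a \<in> U m)"
    and disj: "h1 ` D1 \<inter> h2 ` D2 = {}"
  shows "measurably_separable N (h1 ` D1) (h2 ` D2)"
proof (rule ccontr)
  assume insep: "\<not> ?thesis"
  define cyl :: "nat \<Rightarrow> (nat \<Rightarrow> nat) \<Rightarrow> (nat \<Rightarrow> nat) set" where "cyl = (\<lambda>k a. {b. \<forall>i<k. b i = a i})"
  define R where "R = (\<lambda>k (p::(nat \<Rightarrow> nat) \<times> (nat \<Rightarrow> nat)).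
    \<not> measurably_separable N (h1 ` (D1 \<inter> cyl k (fst p))) (h2 ` (D2 \<inter> cyl k (snd p))))"
  have cyl_Suc: "cyl k a = (\<Union>i. cyl (Suc k) (a(k := i)))" for k a
    by (auto simp: cyl_def less_Suc_eq)
  \<comment> \<open>\<open>\<sigma> k\<close> matters only through its first \<open>k\<close>
    entries; these two prefixes grow by one entry at a time while the images of their cylinders stay
    inseparable.\<close>
  have "\<exists>\<sigma>. \<forall>k. R k (\<sigma> k) \<and> (\<forall>i<k. fst (\<sigma> (Suc k)) i = fst (\<sigma> k) i \<and> snd (\<sigma> (Suc k)) i = snd (\<sigma> k) i)"
  proof (rule dependent_nat_choice)
    show "\<exists>p. R 0 p" using insep by (simp add: R_def cyl_def)
    fix p k assume Rk: "R k p"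
    have "\<exists>i j. R (Suc k) ((fst p)(k := i), (snd p)(k := j))"
    proof (rule ccontr)
      assume "\<not> ?thesis"
      then have "measurably_separable N (\<Union>i. h1 ` (D1 \<inter> cyl (Suc k) ((fst p)(k := i))))
          (\<Union>j. h2 ` (D2 \<inter> cyl (Suc k) ((snd p)(k := j))))"
        using space by (intro measurably_separable_UN) (auto simp: R_def)
      moreover have "h ` (D \<inter> cyl k a) = (\<Union>i. h ` (D \<inter> cyl (Suc k) (a(k := i))))"
        for h :: "(nat \<Rightarrow> nat) \<Rightarrow> 'a" and D a
        by (subst cyl_Suc) (simp only: Int_UN_distrib image_UN)
      ultimately have "\<not> R k p" by (simp only: R_def not_not)
      then show False using Rk by simp
    qed
    then obtain i j where "R (Suc k) ((fst p)(k := i), (snd p)(k := j))" by blast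
    then show "\<exists>q. R (Suc k) q \<and> (\<forall>i<k. fst q i = fst p i \<and> snd q i = snd p i)"
      by (intro exI[of _ "((fst p)(k := i), (snd p)(k := j))"]) auto
  qed
  then obtain \<sigma> where \<sigma>: "\<And>k. R k (\<sigma> k)"
    "\<And>k i. i < k \<Longrightarrow> fst (\<sigma> (Suc k)) i = fst (\<sigma> k) i"
    "\<And>k i. i < k \<Longrightarrow> snd (\<sigma> (Suc k)) i = snd (\<sigma> k) i" by blast
  define a where "a = (\<lambda>i. fst (\<sigma> (Suc i)) i)"
  define b where "b = (\<lambda>i. snd (\<sigma> (Suc i)) i)"
  have "\<forall>i<k. fst (\<sigma> k) i = a i \<and> snd (\<sigma> k) i = b i" for k
    using \<sigma>(2,3) by (induction k) (auto simp: a_def b_def less_Suc_eq)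
  then have "cyl k (fst (\<sigma> k)) = cyl k a" "cyl k (snd (\<sigma> k)) = cyl k b" for k
    by (auto simp: cyl_def)
  then have insep: "\<not> measurably_separable N (h1 ` (D1 \<inter> cyl k a)) (h2 ` (D2 \<inter> cyl k b))" for k
    using \<sigma>(1)[of k] by (simp add: R_def)
  \<comment> \<open>An empty image is trivially separable. Inseparability thus makes the cylinders
    meet the closed sets at every depth, which puts the limit points into them.\<close>
  have "D1 \<inter> cyl k a \<noteq> {}" for k
  proof
    assume "D1 \<inter> cyl k a = {}"
    then have "h1 ` (D1 \<inter> cyl k a) = {}" by simp
    then have "measurably_separable N (h1 ` (D1 \<inter> cyl k a)) (h2 ` (D2 \<inter> cyl k b))"
      unfolding measurably_separable_def by (intro bexI[of _ "{}"]) simp_all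
    then show False using insep by blast
  qed
  then have a: "a \<in> D1" by (intro closed_cylinder_limit[OF closed(1)]) (auto simp: cyl_def)
  have "D2 \<inter> cyl k b \<noteq> {}" for k
  proof
    assume "D2 \<inter> cyl k b = {}"
    then have "h2 ` (D2 \<inter> cyl k b) = {}" by simp
    moreover have "h1 ` (D1 \<inter> cyl k a) \<subseteq> space N" using space by blast
    ultimately have "measurably_separable N (h1 ` (D1 \<inter> cyl k a)) (h2 ` (D2 \<inter> cyl k b))"
      unfolding measurably_separable_def by (intro bexI[of _ "space N"]) simp_all
    then show False using insep by blast
  qed
  then have b: "b \<in> D2" by (intro closed_cylinder_limit[OF closed(2)]) (auto simp: cyl_def)
  have "h1 a \<in> space N" "h2 b \<in> space N" "h1 a \<noteq> h2 b"
    using a b space disj by (auto simp: disjoint_iff)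
  then obtain m where m: "(h1 a \<in> U m) \<noteq> (h2 b \<in> U m)"
    using sep by blast
  obtain k1 where k1: "\<And>c. c \<in> D1 \<Longrightarrow> (\<And>i. i < k1 \<Longrightarrow> c i = a i) \<Longrightarrow> (h1 c \<in> U m) = (h1 a \<in> U m)"
    using continuous_on_bool_locally_constant[OF cont(1) a] by metis
  obtain k2 where k2: "\<And>c. c \<in> D2 \<Longrightarrow> (\<And>i. i < k2 \<Longrightarrow> c i = b i) \<Longrightarrow> (h2 c \<in> U m) = (h2 b \<in> U m)"
    using continuous_on_bool_locally_constant[OF cont(2) b] by metis
  \<comment> \<open>On deep enough cylinders membership in \<open>U m\<close> is constant, with
    opposite values on the two sides.\<close>
  define C where "C = (if h1 a \<in> U m then U m else space N - U m)"
  have "C \<in> sets N" using U by (auto simp: C_def)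
  moreover have "h1 ` (D1 \<inter> cyl (max k1 k2) a) \<subseteq> C"
  proof (rule image_subsetI)
    fix c assume c: "c \<in> D1 \<inter> cyl (max k1 k2) a"
    then have "(h1 c \<in> U m) = (h1 a \<in> U m)" by (intro k1) (auto simp: cyl_def)
    moreover have "h1 c \<in> space N" using c space by blast
    ultimately show "h1 c \<in> C" by (simp add: C_def)
  qed
  moreover have "h2 ` (D2 \<inter> cyl (max k1 k2) b) \<inter> C = {}"
  proof -
    have "h2 c \<notin> C" if c: "c \<in> D2 \<inter> cyl (max k1 k2) b" for c
    proof -
      have "(h2 c \<in> U m) = (h2 b \<in> U m)" using c by (intro k2) (auto simp: cyl_def)
      then show ?thesis using m by (simp add: C_def)
    qed
    then show ?thesis by blast
  qed
  ultimately show False using insep[of "max k1 k2"] unfolding measurably_separable_def by blast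
qed

text \<open>Continuity of the membership predicates, with values in the discrete space of truth values,
  says that the sets \<open>S n\<close> become clopen on \<open>D\<close>.\<close>

definition clopenable :: "(nat \<Rightarrow> (nat \<Rightarrow> nat) set) \<Rightarrow> bool" where
  "clopenable S \<longleftrightarrow> (\<exists>D f. closed D \<and> continuous_on D f \<and> f ` D = (UNIV :: (nat \<Rightarrow> nat) set) \<and>
     (\<forall>n. continuous_on D (\<lambda>a::nat \<Rightarrow> nat. f a \<in> S n)))"

lemma closed_vimage_discrete:
  fixes f :: "'a::topological_space \<Rightarrow> 'b::discrete_topology"
  assumes "closed D" and "continuous_on D f"
  shows "closed {a \<in> D. f a \<in> T}"
proof -
  have "closed T" by (simp add: closed_def open_discrete)
  then have "closed (D \<inter> f -` T)" using continuous_closed_preimage assms by blast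
  then show ?thesis by (simp add: vimage_def Int_def)
qed

lemma continuous_on_comp_discrete:
  fixes f :: "'a::topological_space \<Rightarrow> 'b::discrete_topology" and g :: "'b \<Rightarrow> 'c::topological_space"
  assumes "continuous_on D f"
  shows "continuous_on D (\<lambda>a. g (f a))"
  by (rule continuous_on_compose2[OF Topological_Spaces.continuous_on_discrete assms, of UNIV]) auto

text \<open>The Baire space is its own countable power: a sequence is read as a matrix along the
  pairing function, so that countably many codes fit into one.\<close>

definition baire_column :: "nat \<Rightarrow> (nat \<Rightarrow> nat) \<Rightarrow> nat \<Rightarrow> nat" where
  "baire_column k a = (\<lambda>i. a (prod_encode (k, i)))"

lemma continuous_on_baire_column: "continuous_on D (baire_column k)"
  unfolding baire_column_def
  by (intro continuous_on_coordinatewise_then_product continuous_on_subset[OF continuous_on_product_coordinates]) auto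

lemma baire_column_surj:
  obtains a where "\<And>k. baire_column k a = b k"
proof
  show "baire_column k (\<lambda>n. b (fst (prod_decode n)) (snd (prod_decode n))) = b k" for k
    by (simp add: baire_column_def)
qed

text \<open>The new closed set is the countable fibre product of the given codings: its elements are
  the sequences whose columns all code the same point. Every \<open>S n\<close> is clopen there, by
  way of column \<open>n\<close>.\<close>

lemma clopenable_family:
  assumes "\<And>n. clopenable (\<lambda>_. S n)"
  shows "clopenable S"
proof -
  have "\<forall>n. \<exists>p :: (nat \<Rightarrow> nat) set \<times> ((nat \<Rightarrow> nat) \<Rightarrow> nat \<Rightarrow> nat). closed (fst p) \<and> continuous_on (fst p) (snd p) \<and> snd p ` fst p = UNIV \<and>
      continuous_on (fst p) (\<lambda>a. snd p a \<in> S n)"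
    using assms by (simp add: clopenable_def)
  then obtain p :: "nat \<Rightarrow> (nat \<Rightarrow> nat) set \<times> ((nat \<Rightarrow> nat) \<Rightarrow> nat \<Rightarrow> nat)"
    where p: "\<forall>n. closed (fst (p n)) \<and> continuous_on (fst (p n)) (snd (p n)) \<and>
      snd (p n) ` fst (p n) = UNIV \<and> continuous_on (fst (p n)) (\<lambda>a. snd (p n) a \<in> S n)"
    by (rule choice[THEN exE]) blast
  define D f where "D = (\<lambda>n. fst (p n))" and "f = (\<lambda>n. snd (p n))"
  have Df: "\<And>n. closed (D n)" "\<And>n. continuous_on (D n) (f n)"
    "\<And>n. f n ` D n = UNIV" "\<And>n. continuous_on (D n) (\<lambda>a. f n a \<in> S n)"
    using p by (simp_all add: D_def f_def)
  define E where "E = (\<Inter>n. baire_column n -` D n)"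
  define D' where "D' = (\<Inter>n i. {a \<in> E. f n (baire_column n a) i = f 0 (baire_column 0 a) i})"
  have contE: "continuous_on E (\<lambda>a. h (baire_column n a))" if "continuous_on (D n) h"
    for h :: "(nat \<Rightarrow> nat) \<Rightarrow> 'b::topological_space" and n
    using continuous_on_compose2[OF that continuous_on_baire_column[of E]] by (auto simp: E_def)
  have "closed E" unfolding E_def
    by (intro closed_INT ballI closed_vimage Df continuous_on_baire_column)
  \<comment> \<open>Two natural numbers depending continuously on \<open>a\<close> agree on a closed
    set; equality of points is therefore imposed entry by entry.\<close>
  have "closed {a \<in> E. f n (baire_column n a) i = f 0 (baire_column 0 a) i}" for n i
  proof -
    have "continuous_on E (\<lambda>a. (f 0 (baire_column 0 a) i, f n (baire_column n a) i))"
      by (intro continuous_on_Pair continuous_on_product_then_coordinatewise[OF contE[OF Df(2)]])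
    from continuous_closed_preimage[OF this \<open>closed E\<close> closed_diagonal]
    show ?thesis by (simp add: vimage_def Int_def)
  qed
  then have "closed D'" unfolding D'_def by blast
  have sub: "D' \<subseteq> E" by (auto simp: D'_def)
  have eq: "f n (baire_column n a) = f 0 (baire_column 0 a)" if "a \<in> D'" for a n
    using that by (intro ext) (simp add: D'_def)
  have "continuous_on D' (\<lambda>a. f 0 (baire_column 0 a))"
    using continuous_on_subset[OF contE[OF Df(2)] sub] .
  moreover have "continuous_on D' (\<lambda>a. f 0 (baire_column 0 a) \<in> S n)" for n
    using continuous_on_subset[OF contE[OF Df(4)[of n]] sub] eq[of _ n]
    by (subst continuous_on_cong[OF refl, where g = "\<lambda>a. f n (baire_column n a) \<in> S n"]) auto
  moreover have "c \<in> (\<lambda>a. f 0 (baire_column 0 a)) ` D'" for c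
  proof -
    have "\<exists>b. b \<in> D n \<and> f n b = c" for n
    proof -
      have "c \<in> f n ` D n" using Df(3) by simp
      then show ?thesis by blast
    qed
    then obtain b where b: "\<And>n. b n \<in> D n" "\<And>n. f n (b n) = c" by metis
    obtain a where "\<And>k. baire_column k a = b k" using baire_column_surj by blast
    then have "a \<in> D'" "f 0 (baire_column 0 a) = c" using b by (auto simp: D'_def E_def)
    then show ?thesis by blast
  qed
  ultimately show ?thesis unfolding clopenable_def using \<open>closed D'\<close>
    by (intro exI[of _ D'] exI[of _ "\<lambda>a. f 0 (baire_column 0 a)"]) auto
qed

text \<open>A union of clopen sets is in general only open, so an additional first entry of the code
  records the answer: 0 says that the point lies in no \<open>S j\<close>, and \<open>Suc j\<close>
  that it lies in \<open>S j\<close>. Membership in the union then depends on this entry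
  alone.\<close>

lemma clopenable_UN:
  fixes S :: "nat \<Rightarrow> (nat \<Rightarrow> nat) set"
  assumes "\<And>n. clopenable (\<lambda>_. S n)"
  shows "clopenable (\<lambda>_. \<Union>n. S n)"
proof -
  obtain D and f :: "(nat \<Rightarrow> nat) \<Rightarrow> nat \<Rightarrow> nat" where Df: "closed D" "continuous_on D f"
    "f ` D = UNIV" "\<And>n. continuous_on D (\<lambda>a. f a \<in> S n)"
    using clopenable_family[of S, OF assms] unfolding clopenable_def by blast
  define tail :: "(nat \<Rightarrow> nat) \<Rightarrow> nat \<Rightarrow> nat" where "tail = (\<lambda>a i. a (Suc i))"
  have tail: "continuous_on A tail" for A unfolding tail_def
    by (intro continuous_on_coordinatewise_then_product continuous_on_subset[OF continuous_on_product_coordinates]) auto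
  have hd: "continuous_on A (\<lambda>a::nat \<Rightarrow> nat. a 0)" for A
    by (intro continuous_on_subset[OF continuous_on_product_coordinates]) auto
  define E where "E = tail -` D"
  have contE: "continuous_on E (\<lambda>a. h (tail a))" if "continuous_on D h"
    for h :: "(nat \<Rightarrow> nat) \<Rightarrow> 'b::topological_space"
    using continuous_on_compose2[OF that tail[of E]] by (auto simp: E_def)
  have "closed E" unfolding E_def
    by (intro closed_vimage Df tail)
  \<comment> \<open>Each factor is an implication, written as a union of two closed sets, so the
    infinite intersection is closed.\<close>
  define D' where "D' = (\<Inter>j. ({a \<in> E. a 0 \<in> - {0}} \<union> {a \<in> E. (f (tail a) \<in> S j) \<in> {False}}) \<inter>
     ({a \<in> E. a 0 \<in> - {Suc j}} \<union> {a \<in> E. (f (tail a) \<in> S j) \<in> {True}}))"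
  have "closed D'" unfolding D'_def
    by (intro closed_INT ballI closed_Int closed_Un closed_vimage_discrete[OF \<open>closed E\<close>] hd contE Df)
  have sub: "D' \<subseteq> E" by (auto simp: D'_def)
  have iff: "f (tail a) \<in> (\<Union>n. S n) \<longleftrightarrow> a 0 \<noteq> 0" if "a \<in> D'" for a
  proof (cases "a 0")
    case 0
    then show ?thesis using that by (auto simp: D'_def)
  next
    case (Suc j)
    then show ?thesis using that by (auto simp: D'_def)
  qed
  have "continuous_on D' (\<lambda>a. f (tail a))" using continuous_on_subset[OF contE[OF Df(2)] sub] .
  moreover have "continuous_on D' (\<lambda>a. f (tail a) \<in> (\<Union>n. S n))"
    using continuous_on_comp_discrete[OF hd, of D' "\<lambda>n. n \<noteq> 0"] iff
    by (subst continuous_on_cong[OF refl, where g = "\<lambda>a. a 0 \<noteq> 0"]) auto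
  moreover have "c \<in> (\<lambda>a. f (tail a)) ` D'" for c
  proof -
    have "c \<in> f ` D" using Df(3) by simp
    then obtain b where b: "b \<in> D" "f b = c" by blast
    define m where "m = (if c \<in> (\<Union>n. S n) then Suc (SOME n. c \<in> S n) else 0)"
    define a where "a = case_nat m b"
    have [simp]: "tail a = b" "a 0 = m" by (auto simp: a_def tail_def)
    have "\<forall>j. m = Suc j \<longrightarrow> c \<in> S j" unfolding m_def by (auto intro: someI)
    moreover have "\<forall>j. m = 0 \<longrightarrow> c \<notin> S j" unfolding m_def by auto
    ultimately have "a \<in> D'" using b by (auto simp: D'_def E_def)
    then show ?thesis using b by force
  qed
  ultimately show ?thesis unfolding clopenable_def using \<open>closed D'\<close>
    by (intro exI[of _ D'] exI[of _ "\<lambda>a. f (tail a)"]) auto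
qed

text \<open>Sets given by one coordinate are clopen already, a complement keeps the coding of its
  set, and countable unions are handled by the extra entry.\<close>

lemma clopenable_borel:
  fixes S :: "(nat \<Rightarrow> nat) set"
  assumes "S \<in> sets borel"
  shows "clopenable (\<lambda>_. S)"
proof -
  have "S \<in> sets (\<Pi>\<^sub>M i\<in>(UNIV::nat set). (borel :: nat measure))"
    using assms by (simp add: sets_PiM_equal_borel)
  then have "S \<in> sigma_sets UNIV {{f. f i \<in> A} | i A. A \<in> sets (borel :: nat measure)}"
    by (simp add: sets_PiM_single)
  then show ?thesis
  proof (induction rule: sigma_sets.induct)
    case (Basic S)
    then obtain i A where S: "S = {f. f i \<in> A}" by blast
    have "continuous_on UNIV (\<lambda>a::nat \<Rightarrow> nat. a i \<in> A)"
      by (rule continuous_on_comp_discrete) simp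
    then show ?case unfolding clopenable_def S
      by (intro exI[of _ UNIV] exI[of _ "\<lambda>a. a"]) auto
  next
    case Empty
    then show ?case unfolding clopenable_def
      by (intro exI[of _ UNIV] exI[of _ "\<lambda>a. a"]) auto
  next
    case (Compl S)
    then obtain D and f :: "(nat \<Rightarrow> nat) \<Rightarrow> nat \<Rightarrow> nat" where "closed D" "continuous_on D f" "f ` D = UNIV" "continuous_on D (\<lambda>a. f a \<in> S)"
      unfolding clopenable_def by blast
    then show ?case unfolding clopenable_def
      using continuous_on_comp_discrete[of D "\<lambda>a. f a \<in> S" Not] by auto
  next
    case (Union S)
    then show ?case by (intro clopenable_UN) auto
  qed
qed

text \<open>The only demand that the separation argument makes of its target space. It is applied to
  \<open>M \<Otimes>\<^sub>M M\<close>, and to \<open>M\<close> itself for the diagonal.\<close>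

definition countably_separated :: "'a measure \<Rightarrow> bool" where
  "countably_separated N \<longleftrightarrow> (\<exists>U::nat \<Rightarrow> 'a set. (\<forall>m. U m \<in> sets N) \<and>
     (\<forall>x\<in>space N. \<forall>y\<in>space N. x \<noteq> y \<longrightarrow> (\<exists>m. (x \<in> U m) \<noteq> (y \<in> U m))))"

text \<open>A recoding of the Baire space makes the two sets and the preimages of all
  \<open>U m\<close> clopen, which reduces the claim to closed sets and to maps for which membership
  in each \<open>U m\<close> is continuous.\<close>

theorem lusin_separation:
  fixes B1 B2 :: "(nat \<Rightarrow> nat) set"
  assumes "B1 \<in> sets borel" and "B2 \<in> sets borel"
    and "g1 \<in> borel \<rightarrow>\<^sub>M N" and "g2 \<in> borel \<rightarrow>\<^sub>M N"
    and "countably_separated N" and "g1 ` B1 \<inter> g2 ` B2 = {}"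
  shows "measurably_separable N (g1 ` B1) (g2 ` B2)"
proof -
  obtain U where U: "\<And>m::nat. U m \<in> sets N"
    "\<And>x y. x \<in> space N \<Longrightarrow> y \<in> space N \<Longrightarrow> x \<noteq> y \<Longrightarrow> \<exists>m. (x \<in> U m) \<noteq> (y \<in> U m)"
    using assms(5) unfolding countably_separated_def by metis
  have code: "\<exists>D f. closed D \<and> f ` D = B \<and> (\<forall>m. continuous_on D (\<lambda>a::nat \<Rightarrow> nat. g (f a) \<in> U m))"
    if "B \<in> sets borel" "g \<in> borel \<rightarrow>\<^sub>M N" for B and g :: "(nat \<Rightarrow> nat) \<Rightarrow> 'a"
  proof -
    \<comment> \<open>Index 0 carries the set itself, the later indices carry the preimages.\<close>
    have "clopenable (case_nat B (\<lambda>m. g -` U m))"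
    proof (rule clopenable_family, rule clopenable_borel)
      show "case_nat B (\<lambda>m. g -` U m) n \<in> sets borel" for n
        using that U(1) measurable_sets[OF that(2)] by (cases n) auto
    qed
    then obtain D and f :: "(nat \<Rightarrow> nat) \<Rightarrow> nat \<Rightarrow> nat" where Df: "closed D" "continuous_on D f" "f ` D = UNIV"
      "\<And>n. continuous_on D (\<lambda>a. f a \<in> case_nat B (\<lambda>m. g -` U m) n)"
      unfolding clopenable_def by blast
    let ?D = "{a \<in> D. (f a \<in> B) \<in> {True}}"
    have "closed ?D" using Df(4)[of 0] by (intro closed_vimage_discrete Df) simp
    moreover have "f ` ?D = B" using Df(3) by auto
    moreover have "continuous_on ?D (\<lambda>a. g (f a) \<in> U m)" for m
      using continuous_on_subset[OF Df(4)[of "Suc m"], of ?D] by auto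
    ultimately show ?thesis by blast
  qed
  obtain D1 and f1 :: "(nat \<Rightarrow> nat) \<Rightarrow> nat \<Rightarrow> nat" where 1: "closed D1" "f1 ` D1 = B1" "\<And>m. continuous_on D1 (\<lambda>a. g1 (f1 a) \<in> U m)"
    using code[OF assms(1,3)] by blast
  obtain D2 and f2 :: "(nat \<Rightarrow> nat) \<Rightarrow> nat \<Rightarrow> nat" where 2: "closed D2" "f2 ` D2 = B2" "\<And>m. continuous_on D2 (\<lambda>a. g2 (f2 a) \<in> U m)"
    using code[OF assms(2,4)] by blast
  have "g1 ` B1 = (\<lambda>a. g1 (f1 a)) ` D1" "g2 ` B2 = (\<lambda>a. g2 (f2 a)) ` D2" using 1 2 by auto
  moreover have "g1 a \<in> space N" "g2 a \<in> space N" for a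
    using measurable_space[OF assms(3)] measurable_space[OF assms(4)] by auto
  ultimately show ?thesis using assms(6)
    by (simp only:) (intro lusin_separation_clopen[where U = U] 1 2 U; blast)
qed

section \<open>Borel images of the Baire space\<close>

text \<open>Steps bounded by a geometric series make every sequence in \<open>D\<close> converge,
  and the tail of the series is the error \<open>2 * (1/2) ^ n\<close>. Every point is reached,
  because density allows approximations faster than the bound requires.\<close>

lemma (in Metric_space) baire_parametrization:
  assumes "mcomplete" and "range x \<subseteq> M"
    and dense: "\<And>y e. y \<in> M \<Longrightarrow> 0 < e \<Longrightarrow> \<exists>n::nat. d (x n) y < e"
  defines "D \<equiv> {a. \<forall>n. d (x (a n)) (x (a (Suc n))) \<le> (1/2) ^ n}"
  shows "\<exists>\<rho>. \<rho> ` D = M \<and> (\<forall>a\<in>D. \<forall>n. d (x (a n)) (\<rho> a) \<le> 2 * (1/2) ^ n)"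
proof -
  have xM: "x n \<in> M" for n using assms(2) by blast
  \<comment> \<open>The subtracted term lets the induction close: it exceeds its successor by
    exactly the length \<open>(1/2) ^ (m + k)\<close> allowed for one step.\<close>
  have step: "d (x (a m)) (x (a (m + k))) \<le> 2 * (1/2) ^ m - 2 * (1/2) ^ (m + k)" if "a \<in> D" for a m k
  proof (induction k)
    case 0
    then show ?case using xM by simp
  next
    case (Suc k)
    have "d (x (a m)) (x (a (m + Suc k))) \<le> d (x (a m)) (x (a (m + k))) + d (x (a (m + k))) (x (a (m + Suc k)))"
      using xM by (intro triangle)
    also have "d (x (a (m + k))) (x (a (m + Suc k))) \<le> (1/2) ^ (m + k)"
      using that by (simp add: D_def)
    finally show ?case using Suc by simp
  qed
  have cauchy: "d (x (a m)) (x (a n)) \<le> 2 * (1/2) ^ m" if "a \<in> D" "m \<le> n" for a m n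
  proof -
    have "d (x (a m)) (x (a n)) \<le> 2 * (1/2) ^ m - 2 * (1/2) ^ n"
      using step[OF that(1), of m "n - m"] that(2) by simp
    moreover have "0 \<le> 2 * (1/2 :: real) ^ n" by simp
    ultimately show ?thesis by linarith
  qed
  have small: "\<exists>n. 2 * (1/2 :: real) ^ n < e" if "0 < e" for e
    using real_arch_pow_inv[of "e / 2" "1/2"] that by (auto simp: field_simps)
  have "\<exists>l\<in>M. \<forall>n. d (x (a n)) l \<le> 2 * (1/2) ^ n" if a: "a \<in> D" for a
  proof -
    have "MCauchy (\<lambda>n. x (a n))"
      unfolding MCauchy_def
    proof (intro conjI allI impI)
      show "range (\<lambda>n. x (a n)) \<subseteq> M" using xM by blast
      fix e :: real assume "0 < e"
      then obtain N where N: "2 * (1/2 :: real) ^ N < e" using small by blast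
      have "d (x (a n)) (x (a m)) < e" if "N \<le> n" "n \<le> m" for n m
      proof -
        have "(1/2 :: real) ^ n \<le> (1/2) ^ N" using that(1) by (intro power_decreasing) auto
        then show ?thesis using cauchy[OF a that(2)] N by linarith
      qed
      then show "\<exists>N. \<forall>n n'. N \<le> n \<longrightarrow> N \<le> n' \<longrightarrow> d (x (a n)) (x (a n')) < e"
        by (metis commute nat_le_linear)
    qed
    then obtain l where l: "l \<in> M" "\<And>e. 0 < e \<Longrightarrow> \<exists>N. \<forall>n\<ge>N. d (x (a n)) l < e"
      using assms(1) unfolding mcomplete_def limit_metric_sequentially by metis
    have "d (x (a n)) l \<le> 2 * (1/2) ^ n" for n
    proof (rule field_le_epsilon)
      fix e :: real assume "0 < e"
      then obtain N where "\<forall>k\<ge>N. d (x (a k)) l < e" using l(2) by blast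
      then have "d (x (a (max N n))) l < e" by simp
      moreover have "d (x (a n)) l \<le> d (x (a n)) (x (a (max N n))) + d (x (a (max N n))) l"
        using xM l(1) by (intro triangle)
      moreover have "d (x (a n)) (x (a (max N n))) \<le> 2 * (1/2) ^ n" using cauchy[OF a] by simp
      ultimately show "d (x (a n)) l \<le> 2 * (1/2) ^ n + e" by linarith
    qed
    then show ?thesis using l(1) by blast
  qed
  then obtain \<rho> where \<rho>: "\<And>a. a \<in> D \<Longrightarrow> \<rho> a \<in> M" "\<And>a n. a \<in> D \<Longrightarrow> d (x (a n)) (\<rho> a) \<le> 2 * (1/2) ^ n"
    by metis
  have "y \<in> \<rho> ` D" if y: "y \<in> M" for y
  proof -
    \<comment> \<open>With half the allowed step, consecutive points are closer than
      \<open>(1/2) ^ n / 2 + (1/2) ^ n / 4\<close>, within the bound that defines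
      \<open>D\<close>.\<close>
    have "\<exists>k. d (x k) y < (1/2) ^ n / 2" for n using dense[OF y, of "(1/2) ^ n / 2"] by simp
    then obtain a where a: "\<And>n. d (x (a n)) y < (1/2) ^ n / 2" by metis
    have "a \<in> D"
      unfolding D_def
    proof (intro CollectI allI)
      fix n
      have "d (x (a n)) (x (a (Suc n))) \<le> d (x (a n)) y + d (x (a (Suc n))) y"
        using xM y by (intro triangle')
      moreover have "d (x (a (Suc n))) y < (1/2) ^ n / 4" using a[of "Suc n"] by simp
      moreover have "0 < (1/2 :: real) ^ n" by simp
      ultimately show "d (x (a n)) (x (a (Suc n))) \<le> (1/2) ^ n"
        using a[of n] by linarith
    qed
    have "d (\<rho> a) y \<le> 0"
    proof (rule field_le_epsilon)
      fix e :: real assume "0 < e"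
      then obtain n where n: "2 * (1/2 :: real) ^ n < e / 2" using small[of "e / 2"] by auto
      have "d (\<rho> a) y \<le> d (x (a n)) (\<rho> a) + d (x (a n)) y"
        using xM y \<rho>(1)[OF \<open>a \<in> D\<close>] by (intro triangle'')
      also have "\<dots> \<le> 2 * (1/2) ^ n + (1/2) ^ n / 2" using \<rho>(2)[OF \<open>a \<in> D\<close>, of n] a[of n] by linarith
      also have "\<dots> \<le> 0 + e" using n zero_le_power[of "1/2 :: real" n] by linarith
      finally show "d (\<rho> a) y \<le> 0 + e" .
    qed
    then have "\<rho> a = y" using \<rho>(1)[OF \<open>a \<in> D\<close>] y by (metis nonneg order_antisym zero)
    then show ?thesis using \<open>a \<in> D\<close> by blast
  qed
  then show ?thesis using \<rho> by blast
qed

text \<open>Such a parametrization turns images of measurable subsets of \<open>N\<close> into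
  images of Borel sets of sequences, and it is inherited by countable powers. It forces
  \<open>space N\<close> to be nonempty.\<close>

definition baire_image_space :: "'a measure \<Rightarrow> bool" where
  "baire_image_space N \<longleftrightarrow> (\<exists>\<rho> \<in> (borel :: (nat \<Rightarrow> nat) measure) \<rightarrow>\<^sub>M N. range \<rho> = space N)"

lemma measurable_baire_coordinate:
  "(\<lambda>a::nat \<Rightarrow> nat. a n) \<in> borel \<rightarrow>\<^sub>M count_space UNIV"
proof (rule measurableI)
  fix A :: "nat set"
  have "open ((\<lambda>a::nat \<Rightarrow> nat. a n) -` A)"
    by (rule open_vimage[OF open_discrete continuous_on_product_coordinates])
  then show "(\<lambda>a::nat \<Rightarrow> nat. a n) -` A \<inter> space borel \<in> sets borel" by simp
qed simp

lemma standard_borel_space_baire_image: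
  assumes "standard_borel_space M" and "space M \<noteq> {}"
  shows "baire_image_space M"
proof -
  obtain X where X: "completely_metrizable_space X" "second_countable X"
    "space M = topspace X" "sets M = sigma_sets (topspace X) {U. openin X U}"
    using assms(1) unfolding standard_borel_space_def by blast
  obtain V d where "Metric_space V d" and compl: "Metric_space.mcomplete V d"
    and X_eq: "X = Metric_space.mtopology V d"
    using X(1) unfolding completely_metrizable_space_def by blast
  interpret Metric_space V d by fact
  have V: "topspace X = V" by (simp add: X_eq)
  obtain C where C: "countable C" "C \<subseteq> V" "X closure_of C = V"
    using second_countable_imp_separable_space[OF X(2)] V unfolding separable_space_def by auto
  have "C \<noteq> {}" using C(3) assms(2) X(3) V by auto
  define x where "x = from_nat_into C"
  have range_x: "range x = C" unfolding x_def using C(1) \<open>C \<noteq> {}\<close> by (rule range_from_nat_into[rotated])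
  have dense: "\<exists>n. d (x n) y < e" if y: "y \<in> V" and e: "0 < e" for y e
  proof -
    have "y \<in> mtopology closure_of C" using y C(3) X_eq by simp
    then obtain z where "z \<in> C" "z \<in> mball y e" using e by (auto simp: metric_closure_of)
    then show ?thesis using range_x by (metis (no_types, lifting) commute imageE in_mball)
  qed
  define D where "D = {a. \<forall>n. d (x (a n)) (x (a (Suc n))) \<le> (1/2) ^ n}"
  obtain \<rho> where \<rho>: "\<rho> ` D = V" "\<And>a n. a \<in> D \<Longrightarrow> d (x (a n)) (\<rho> a) \<le> 2 * (1/2) ^ n"
  proof -
    have "range x \<subseteq> V" using range_x C(2) by simp
    from baire_parametrization[OF compl this dense] show ?thesis
      using that unfolding D_def by blast
  qed
  \<comment> \<open>Outside the Borel set \<open>D\<close> nothing is known about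
    \<open>\<rho>\<close>; the constant \<open>x 0\<close> makes the map total and keeps it
    measurable.\<close>
  define \<rho>' where "\<rho>' = (\<lambda>a. if a \<in> D then \<rho> a else x 0)"
  have xV: "x n \<in> V" for n using range_x C(2) by blast
  have \<rho>V: "\<rho> a \<in> V" if "a \<in> D" for a using \<rho>(1) that by blast
  note coord = measurable_baire_coordinate
  have "{a. d (x (a n)) (x (a (Suc n))) \<le> (1/2) ^ n} \<in> sets borel" for n
  proof -
    have "(\<lambda>a::nat \<Rightarrow> nat. (a n, a (Suc n))) \<in> borel \<rightarrow>\<^sub>M count_space UNIV \<Otimes>\<^sub>M count_space UNIV"
      by (intro measurable_Pair coord)
    then have "(\<lambda>a::nat \<Rightarrow> nat. (a n, a (Suc n))) \<in> borel \<rightarrow>\<^sub>M count_space UNIV"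
      by (simp add: pair_measure_countable)
    from measurable_sets[OF this, of "{(i, j). d (x i) (x j) \<le> (1/2) ^ n}"]
    show ?thesis by (simp add: vimage_def)
  qed
  then have D: "D \<in> sets borel"
    unfolding D_def by (subst Collect_all_eq) (intro sets.countable_INT'', auto)
  have "\<rho>' \<in> borel \<rightarrow>\<^sub>M M"
  proof (rule measurable_sigma_sets[OF X(4)])
    show "{U. openin X U} \<subseteq> Pow (topspace X)" by (auto dest: openin_subset)
    show "\<rho>' \<in> space borel \<rightarrow> topspace X" using \<rho>V xV by (auto simp: \<rho>'_def V)
    fix U assume "U \<in> {U. openin X U}"
    then have U: "openin mtopology U" using X_eq by simp
    \<comment> \<open>Membership of the limit in an open set shows at a finite stage: the radius
      \<open>4 * (1/2) ^ n\<close> exceeds the error \<open>2 * (1/2) ^ n\<close>, so the ball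
      contains \<open>\<rho> a\<close>, and the balls shrink to that point.\<close>
    define W where "W = (\<Union>n. {a::nat \<Rightarrow> nat. mball (x (a n)) (4 * (1/2) ^ n) \<subseteq> U})"
    have "{a::nat \<Rightarrow> nat. mball (x (a n)) (4 * (1/2) ^ n) \<subseteq> U} \<in> sets borel" for n
      using measurable_sets[OF coord[of n], of "{k. mball (x k) (4 * (1/2) ^ n) \<subseteq> U}"] by (simp add: vimage_def)
    then have W: "W \<in> sets borel" unfolding W_def by blast
    have "\<rho> a \<in> U \<longleftrightarrow> a \<in> W" if a: "a \<in> D" for a
    proof
      assume "a \<in> W"
      then obtain n where n: "mball (x (a n)) (4 * (1/2) ^ n) \<subseteq> U" by (auto simp: W_def)
      have "d (x (a n)) (\<rho> a) < 4 * (1/2) ^ n"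
        using \<rho>(2)[OF a, of n] zero_less_power[of "1/2 :: real" n] by linarith
      then show "\<rho> a \<in> U" using n xV \<rho>V[OF a] by auto
    next
      assume "\<rho> a \<in> U"
      then obtain e where e: "0 < e" "mball (\<rho> a) e \<subseteq> U" using U by (auto simp: openin_mtopology)
      \<comment> \<open>The factor 6 is the radius 4 plus the error 2.\<close>
      obtain n where n: "(1/2 :: real) ^ n < e / 6" using real_arch_pow_inv[of "e / 6" "1/2"] e(1) by auto
      have "z \<in> mball (\<rho> a) e" if z: "z \<in> mball (x (a n)) (4 * (1/2) ^ n)" for z
      proof -
        have "d (\<rho> a) z \<le> d (x (a n)) (\<rho> a) + d (x (a n)) z"
          using z xV \<rho>V[OF a] by (intro triangle'') auto
        also have "\<dots> < e" using \<rho>(2)[OF a, of n] z n by simp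
        finally show ?thesis using z \<rho>V[OF a] by auto
      qed
      then have "mball (x (a n)) (4 * (1/2) ^ n) \<subseteq> U" using e(2) by (meson subsetD subsetI)
      then show "a \<in> W" by (auto simp: W_def)
    qed
    then have "\<rho>' -` U \<inter> space borel = D \<inter> W \<union> (if x 0 \<in> U then - D else {})"
      by (auto simp: \<rho>'_def split: if_splits)
    then show "\<rho>' -` U \<inter> space borel \<in> sets borel" using D W by auto
  qed
  moreover have "range \<rho>' = space M"
    using \<rho>(1) xV by (auto simp: \<rho>'_def X(3) V image_iff)
  ultimately show ?thesis unfolding baire_image_space_def by blast
qed

lemma standard_borel_space_countably_separated:
  assumes "standard_borel_space M"
  shows "countably_separated M"
proof -
  obtain X where X: "completely_metrizable_space X" "second_countable X"
    "space M = topspace X" "sets M = sigma_sets (topspace X) {U. openin X U}"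
    using assms unfolding standard_borel_space_def by blast
  obtain \<B> where "countable \<B> \<and> (\<forall>V\<in>\<B>. openin X V) \<and>
      (\<forall>U x. openin X U \<and> x \<in> U \<longrightarrow> (\<exists>V\<in>\<B>. x \<in> V \<and> V \<subseteq> U))"
    using X(2) unfolding second_countable_def ..
  then have \<B>: "countable \<B>" "\<And>V. V \<in> \<B> \<Longrightarrow> openin X V"
    "\<And>U x. openin X U \<Longrightarrow> x \<in> U \<Longrightarrow> \<exists>V\<in>\<B>. x \<in> V \<and> V \<subseteq> U" by simp_all
  \<comment> \<open>The empty set is inserted so that there is something to enumerate even if the
    base is empty.\<close>
  define U where "U = from_nat_into (insert {} \<B>)"
  have range_U: "range U = insert {} \<B>"
    unfolding U_def using \<B>(1) by (intro range_from_nat_into) auto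
  have "U m \<in> sets M" for m
  proof -
    have "U m \<in> insert {} \<B>" using range_U by blast
    then show ?thesis using \<B>(2) X(4) by auto
  qed
  moreover have "\<exists>m. (x \<in> U m) \<noteq> (y \<in> U m)" if "x \<in> space M" "y \<in> space M" "x \<noteq> y" for x y
  proof -
    have "Hausdorff_space X"
      using X(1) completely_metrizable_imp_metrizable_space metrizable_imp_Hausdorff_space by blast
    then have "\<exists>U V. openin X U \<and> openin X V \<and> x \<in> U \<and> y \<in> V \<and> disjnt U V"
      using that X(3) unfolding Hausdorff_space_def by simp
    then obtain O1 O2 where O: "openin X O1" "openin X O2" "x \<in> O1" "y \<in> O2" "disjnt O1 O2"
      by blast
    obtain V where "V \<in> \<B>" "x \<in> V" "V \<subseteq> O1" using \<B>(3)[OF O(1,3)] by blast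
    moreover obtain m where "U m = V" using range_U \<open>V \<in> \<B>\<close> by (metis imageE insertI2)
    ultimately have "x \<in> U m" "y \<notin> U m" using O by (auto simp: disjnt_def)
    then show ?thesis by blast
  qed
  ultimately show ?thesis unfolding countably_separated_def by blast
qed

lemma countably_separated_pair:
  assumes "countably_separated M" and "countably_separated N"
  shows "countably_separated (M \<Otimes>\<^sub>M N)"
proof -
  obtain U :: "nat \<Rightarrow> 'a set" where U: "\<And>m. U m \<in> sets M"
    "\<And>x y. x \<in> space M \<Longrightarrow> y \<in> space M \<Longrightarrow> x \<noteq> y \<Longrightarrow> \<exists>m. (x \<in> U m) \<noteq> (y \<in> U m)"
    using assms(1) unfolding countably_separated_def by metis
  obtain W :: "nat \<Rightarrow> 'b set" where W: "\<And>m. W m \<in> sets N"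
    "\<And>x y. x \<in> space N \<Longrightarrow> y \<in> space N \<Longrightarrow> x \<noteq> y \<Longrightarrow> \<exists>m. (x \<in> W m) \<noteq> (y \<in> W m)"
    using assms(2) unfolding countably_separated_def by metis
  define R where "R = (\<lambda>m. if even m then U (m div 2) \<times> space N else space M \<times> W (m div 2))"
  have R: "R (2 * m) = U m \<times> space N" "R (Suc (2 * m)) = space M \<times> W m" for m
    by (auto simp: R_def)
  have "R m \<in> sets (M \<Otimes>\<^sub>M N)" for m using U(1) W(1) by (auto simp: R_def)
  moreover have "\<exists>m. (p \<in> R m) \<noteq> (q \<in> R m)"
    if p: "p \<in> space (M \<Otimes>\<^sub>M N)" and q: "q \<in> space (M \<Otimes>\<^sub>M N)" and "p \<noteq> q" for p q
  proof (cases "fst p = fst q")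
    case True
    then have "snd p \<noteq> snd q" using \<open>p \<noteq> q\<close> by (simp add: prod_eq_iff)
    moreover have "snd p \<in> space N" "snd q \<in> space N" using p q by (auto simp: space_pair_measure)
    ultimately obtain m where "(snd p \<in> W m) \<noteq> (snd q \<in> W m)" using W(2) by blast
    then have "(p \<in> R (Suc (2 * m))) \<noteq> (q \<in> R (Suc (2 * m)))"
      using p q by (auto simp: R space_pair_measure)
    then show ?thesis by blast
  next
    case False
    moreover have "fst p \<in> space M" "fst q \<in> space M" using p q by (auto simp: space_pair_measure)
    ultimately obtain m where "(fst p \<in> U m) \<noteq> (fst q \<in> U m)" using U(2) by blast
    then have "(p \<in> R (2 * m)) \<noteq> (q \<in> R (2 * m))"
      using p q by (auto simp: R space_pair_measure)
    then show ?thesis by blast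
  qed
  ultimately show ?thesis unfolding countably_separated_def by blast
qed

text \<open>Distinct points are told apart by some \<open>U m\<close>, so the complement of the
  diagonal is a countable union of rectangles. This makes inequality of two listed vertices a
  measurable condition.\<close>

lemma countably_separated_diagonal:
  assumes "countably_separated M"
  shows "{p \<in> space (M \<Otimes>\<^sub>M M). fst p = snd p} \<in> sets (M \<Otimes>\<^sub>M M)"
proof -
  obtain U :: "nat \<Rightarrow> 'a set" where U: "\<And>m. U m \<in> sets M"
    "\<And>x y. x \<in> space M \<Longrightarrow> y \<in> space M \<Longrightarrow> x \<noteq> y \<Longrightarrow> \<exists>m. (x \<in> U m) \<noteq> (y \<in> U m)"
    using assms unfolding countably_separated_def by metis
  let ?R = "space (M \<Otimes>\<^sub>M M) - (\<Union>m. U m \<times> (space M - U m) \<union> (space M - U m) \<times> U m)"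
  have "{p \<in> space (M \<Otimes>\<^sub>M M). fst p = snd p} = ?R"
  proof (intro set_eqI iffI)
    fix p assume p: "p \<in> ?R"
    have "fst p = snd p"
    proof (rule ccontr)
      assume "fst p \<noteq> snd p"
      moreover have "fst p \<in> space M" "snd p \<in> space M" using p by (auto simp: space_pair_measure)
      ultimately obtain m where "(fst p \<in> U m) \<noteq> (snd p \<in> U m)" using U(2) by blast
      then show False using p by (auto simp: space_pair_measure)
    qed
    then show "p \<in> {p \<in> space (M \<Otimes>\<^sub>M M). fst p = snd p}" using p by simp
  qed (auto simp: space_pair_measure)
  also have "\<dots> \<in> sets (M \<Otimes>\<^sub>M M)"
    using U(1) by (intro sets.Diff sets.top sets.countable_UN'' sets.Un pair_measureI) auto
  finally show ?thesis .
qed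

text \<open>Each index reads its own column, so the coordinates can be coded independently of each
  other.\<close>

lemma baire_image_space_PiM:
  fixes J :: "'i::countable set"
  assumes "baire_image_space M"
  shows "baire_image_space (\<Pi>\<^sub>M i\<in>J. M)"
proof -
  obtain \<rho> where \<rho>: "\<rho> \<in> (borel :: (nat \<Rightarrow> nat) measure) \<rightarrow>\<^sub>M M" "range \<rho> = space M"
    using assms unfolding baire_image_space_def by blast
  define \<tau> where "\<tau> = (\<lambda>a. \<lambda>i\<in>J. \<rho> (baire_column (to_nat i) a))"
  have "\<tau> \<in> borel \<rightarrow>\<^sub>M (\<Pi>\<^sub>M i\<in>J. M)" unfolding \<tau>_def
    using borel_measurable_continuous_onI[OF continuous_on_baire_column]
    by (intro measurable_restrict measurable_compose[OF _ \<rho>(1)])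
  moreover have "range \<tau> = space (\<Pi>\<^sub>M i\<in>J. M)"
  proof
    show "range \<tau> \<subseteq> space (\<Pi>\<^sub>M i\<in>J. M)" using \<rho>(2) by (auto simp: \<tau>_def space_PiM)
    show "space (\<Pi>\<^sub>M i\<in>J. M) \<subseteq> range \<tau>"
    proof
      fix w assume w: "w \<in> space (\<Pi>\<^sub>M i\<in>J. M)"
      have "\<exists>b. \<rho> b = w i" if "i \<in> J" for i
      proof -
        have "w i \<in> range \<rho>" using w that \<rho>(2) by (auto simp: space_PiM PiE_iff)
        then show ?thesis by (metis rangeE)
      qed
      then obtain b where b: "\<And>i. i \<in> J \<Longrightarrow> \<rho> (b i) = w i" by metis
      obtain a where a: "\<And>k. baire_column k a = b (from_nat k)"
        using baire_column_surj[of "\<lambda>k. b (from_nat k)"] by blast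
      have "\<tau> a = w" using w b by (auto simp: \<tau>_def a space_PiM PiE_iff extensional_def)
      then show "w \<in> range \<tau>" by blast
    qed
  qed
  ultimately show ?thesis unfolding baire_image_space_def by blast
qed

lemma baire_image_space_separation:
  assumes "baire_image_space W1" and "baire_image_space W2" and "countably_separated N"
    and "B1 \<in> sets W1" and "B2 \<in> sets W2" and "g1 \<in> W1 \<rightarrow>\<^sub>M N" and "g2 \<in> W2 \<rightarrow>\<^sub>M N"
    and "g1 ` B1 \<inter> g2 ` B2 = {}"
  shows "measurably_separable N (g1 ` B1) (g2 ` B2)"
proof -
  obtain \<rho>1 where 1: "\<rho>1 \<in> (borel :: (nat \<Rightarrow> nat) measure) \<rightarrow>\<^sub>M W1" "range \<rho>1 = space W1"
    using assms(1) unfolding baire_image_space_def by blast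
  obtain \<rho>2 where 2: "\<rho>2 \<in> (borel :: (nat \<Rightarrow> nat) measure) \<rightarrow>\<^sub>M W2" "range \<rho>2 = space W2"
    using assms(2) unfolding baire_image_space_def by blast
  have "\<rho>1 ` (\<rho>1 -` B1) = B1" "\<rho>2 ` (\<rho>2 -` B2) = B2"
    using 1(2) 2(2) sets.sets_into_space[OF assms(4)] sets.sets_into_space[OF assms(5)] by auto
  then have eq: "(\<lambda>a. g1 (\<rho>1 a)) ` (\<rho>1 -` B1) = g1 ` B1" "(\<lambda>a. g2 (\<rho>2 a)) ` (\<rho>2 -` B2) = g2 ` B2"
    by (metis image_image)+
  have "measurably_separable N ((\<lambda>a. g1 (\<rho>1 a)) ` (\<rho>1 -` B1)) ((\<lambda>a. g2 (\<rho>2 a)) ` (\<rho>2 -` B2))"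
  proof (rule lusin_separation)
    show "\<rho>1 -` B1 \<in> sets borel" "\<rho>2 -` B2 \<in> sets borel"
      using measurable_sets[OF 1(1) assms(4)] measurable_sets[OF 2(1) assms(5)] by simp_all
    show "(\<lambda>a. g1 (\<rho>1 a)) \<in> borel \<rightarrow>\<^sub>M N" "(\<lambda>a. g2 (\<rho>2 a)) \<in> borel \<rightarrow>\<^sub>M N"
      using measurable_compose[OF 1(1) assms(6)] measurable_compose[OF 2(1) assms(7)] by simp_all
  qed (use assms eq in simp_all)
  then show ?thesis by (simp only: eq)
qed

text \<open>Each level set of \<open>f\<close> is analytic, and so is its complement in \<open>G\<close>, the union of the other
  level sets.\<close>

lemma measurable_analytic_partition:
  fixes f :: "'b \<Rightarrow> real"
  assumes W: "baire_image_space W" and N: "countably_separated N" and G: "G \<in> sets N"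
    and I: "countable I" and B: "\<And>i. i \<in> I \<Longrightarrow> B i \<in> sets W"
    and g: "\<And>i. i \<in> I \<Longrightarrow> g i \<in> W \<rightarrow>\<^sub>M N" and cover: "G = (\<Union>i\<in>I. g i ` B i)"
    and const: "\<And>i w. i \<in> I \<Longrightarrow> w \<in> B i \<Longrightarrow> f (g i w) = c i"
  shows "f \<in> borel_measurable (restrict_space N G)"
proof -
  have level: "{x \<in> G. f x \<in> R} \<in> sets N" for R
  proof -
    let ?I1 = "{i \<in> I. c i \<in> R}" and ?I2 = "{i \<in> I. c i \<notin> R}"
    \<comment> \<open>Pieces may overlap within each of the two groups, but not across them: a
      common point would have two values of \<open>f\<close>, one in \<open>R\<close> and one
      outside.\<close>
    have "measurably_separable N (\<Union>i\<in>?I1. g i ` B i) (\<Union>i\<in>?I2. g i ` B i)"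
    proof (rule measurably_separable_UN)
      show "g i ` B i \<subseteq> space N" if "i \<in> ?I1" for i
        using that sets.sets_into_space[OF B, of i] measurable_space[OF g, of i] by auto
      show "measurably_separable N (g i ` B i) (g j ` B j)" if "i \<in> ?I1" "j \<in> ?I2" for i j
      proof (rule baire_image_space_separation[OF W W N])
        have "g i v \<noteq> g j w" if "v \<in> B i" "w \<in> B j" for v w
          using const[of i v] const[of j w] that \<open>i \<in> ?I1\<close> \<open>j \<in> ?I2\<close> by auto
        then show "g i ` B i \<inter> g j ` B j = {}" by blast
      qed (use that B g in auto)
    qed (use I in auto)
    then obtain C where C: "C \<in> sets N" "(\<Union>i\<in>?I1. g i ` B i) \<subseteq> C" "(\<Union>i\<in>?I2. g i ` B i) \<inter> C = {}"
      unfolding measurably_separable_def by blast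
    have "{x \<in> G. f x \<in> R} = G \<inter> C"
    proof (intro set_eqI iffI)
      fix x assume x: "x \<in> {x \<in> G. f x \<in> R}"
      then obtain i w where "i \<in> I" "w \<in> B i" "x = g i w" using cover by blast
      then show "x \<in> G \<inter> C" using x C(2) const[of i w] by auto
    next
      fix x assume x: "x \<in> G \<inter> C"
      then obtain i w where iw: "i \<in> I" "w \<in> B i" "x = g i w" using cover by blast
      have "c i \<in> R" using iw x C(3) by blast
      then show "x \<in> {x \<in> G. f x \<in> R}" using x iw const[of i w] by auto
    qed
    then show ?thesis using G C(1) by auto
  qed
  have "G \<inter> space N = G" using sets.sets_into_space[OF G] by blast
  then show ?thesis
    using level G by (intro measurableI) (auto simp: space_restrict_space sets_restrict_space_iff vimage_def Int_def conj_commute)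
qed

section \<open>Invariant weights on graphs with half-edges\<close>

text \<open>Neither finiteness nor symmetry is demanded, so that \<open>half_nbhd G S\<close>
  qualifies for every \<open>G\<close> and \<open>S\<close>.\<close>

definition wf_half_edge_graph :: "('v, 'h) half_edge_graph \<Rightarrow> bool" where
  "wf_half_edge_graph F \<longleftrightarrow> hedges F \<subseteq> hverts F \<times> hverts F \<and> incid F ` halfs F \<subseteq> hverts F"

lemma wf_half_edge_graph_half_nbhd: "wf_half_edge_graph (half_nbhd G S)"
  by (auto simp: wf_half_edge_graph_def half_nbhd_def)

lemma half_edge_graph_iso_trans:
  assumes "wf_half_edge_graph F" and "half_edge_graph_iso \<phi> \<psi> F F'" and "half_edge_graph_iso \<phi>' \<psi>' F' F''"
  shows "half_edge_graph_iso (\<lambda>x. \<phi>' (\<phi> x)) (\<lambda>h. \<psi>' (\<psi> h)) F F''"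
proof -
  have "\<phi> x \<in> hverts F'" if "x \<in> hverts F" for x
    using assms(2) that by (auto simp: half_edge_graph_iso_def bij_betw_def)
  moreover have "\<psi> h \<in> halfs F'" if "h \<in> halfs F" for h
    using assms(2) that by (auto simp: half_edge_graph_iso_def bij_betw_def)
  moreover have "bij_betw (\<lambda>x. \<phi>' (\<phi> x)) (hverts F) (hverts F'')" "bij_betw (\<lambda>h. \<psi>' (\<psi> h)) (halfs F) (halfs F'')"
    using assms(2,3) bij_betw_trans unfolding half_edge_graph_iso_def comp_def by blast+
  ultimately show ?thesis
    using assms unfolding half_edge_graph_iso_def by simp
qed

lemma half_edge_graph_iso_inv:
  assumes "wf_half_edge_graph F" and "half_edge_graph_iso \<phi> \<psi> F F'"
  shows "half_edge_graph_iso (inv_into (hverts F) \<phi>) (inv_into (halfs F) \<psi>) F' F"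
proof -
  let ?\<phi> = "inv_into (hverts F) \<phi>" and ?\<psi> = "inv_into (halfs F) \<psi>"
  have b: "bij_betw \<phi> (hverts F) (hverts F')" "bij_betw \<psi> (halfs F) (halfs F')"
    and e: "\<And>x y. x \<in> hverts F \<Longrightarrow> y \<in> hverts F \<Longrightarrow> (x, y) \<in> hedges F \<longleftrightarrow> (\<phi> x, \<phi> y) \<in> hedges F'"
    and i: "\<And>h. h \<in> halfs F \<Longrightarrow> incid F' (\<psi> h) = \<phi> (incid F h)"
    using assms(2) unfolding half_edge_graph_iso_def by simp_all
  have b': "bij_betw ?\<phi> (hverts F') (hverts F)" "bij_betw ?\<psi> (halfs F') (halfs F)"
    using b by (simp_all add: bij_betw_inv_into)
  have v: "?\<phi> x \<in> hverts F \<and> \<phi> (?\<phi> x) = x" if "x \<in> hverts F'" for x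
    using b(1) b'(1) that by (simp add: bij_betw_apply bij_betw_inv_into_right)
  have h: "?\<psi> k \<in> halfs F \<and> \<psi> (?\<psi> k) = k" if "k \<in> halfs F'" for k
    using b(2) b'(2) that by (simp add: bij_betw_apply bij_betw_inv_into_right)
  have "incid F (?\<psi> k) = ?\<phi> (incid F' k)" if "k \<in> halfs F'" for k
  proof -
    have "incid F (?\<psi> k) \<in> hverts F" using assms(1) h[OF that] by (auto simp: wf_half_edge_graph_def)
    then have "?\<phi> (\<phi> (incid F (?\<psi> k))) = incid F (?\<psi> k)" using b(1) by (simp add: bij_betw_inv_into_left)
    then show ?thesis using i[of "?\<psi> k"] h[OF that] by simp
  qed
  then show ?thesis unfolding half_edge_graph_iso_def using b' e v by simp
qed

text \<open>Isomorphisms are total functions with arbitrary values off the graph; between finite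
  graphs only finitely many remain after truncation, and an average over them makes sense.\<close>

lemma half_edge_graph_iso_restrict:
  assumes "wf_half_edge_graph F" and "half_edge_graph_iso \<phi> \<psi> F F'"
  shows "half_edge_graph_iso (restrict \<phi> (hverts F)) (restrict \<psi> (halfs F)) F F'"
proof -
  have "bij_betw (restrict \<phi> (hverts F)) (hverts F) (hverts F')" "bij_betw (restrict \<psi> (halfs F)) (halfs F) (halfs F')"
    using assms(2) unfolding half_edge_graph_iso_def by (auto cong: bij_betw_cong)
  moreover have "incid F h \<in> hverts F" if "h \<in> halfs F" for h
    using assms(1) that by (auto simp: wf_half_edge_graph_def)
  ultimately show ?thesis using assms(2) unfolding half_edge_graph_iso_def by simp
qed

text \<open>Neighbours of \<open>i\<close> and half-edges at \<open>i\<close> are carried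
  bijectively to those of \<open>\<phi> i\<close>. All transport of vertex sums between tiles and
  \<open>F\<close> goes through these two identities.\<close>

lemma half_edge_graph_iso_sum:
  assumes "wf_half_edge_graph F" and "wf_half_edge_graph F'" and "half_edge_graph_iso \<phi> \<psi> F F'" and "i \<in> hverts F"
  shows "(\<Sum>j\<in>hedges F `` {i}. g (\<phi> j)) = (\<Sum>y\<in>hedges F' `` {\<phi> i}. g y)"
    and "(\<Sum>h | h \<in> halfs F \<and> incid F h = i. g' (\<psi> h)) = (\<Sum>k | k \<in> halfs F' \<and> incid F' k = \<phi> i. g' k)"
proof -
  have b: "inj_on \<phi> (hverts F)" "\<phi> ` hverts F = hverts F'" "inj_on \<psi> (halfs F)" "\<psi> ` halfs F = halfs F'"
    and e: "\<And>x y. x \<in> hverts F \<Longrightarrow> y \<in> hverts F \<Longrightarrow> (x, y) \<in> hedges F \<longleftrightarrow> (\<phi> x, \<phi> y) \<in> hedges F'"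
    and i: "\<And>h. h \<in> halfs F \<Longrightarrow> incid F' (\<psi> h) = \<phi> (incid F h)"
    using assms(3) unfolding half_edge_graph_iso_def bij_betw_def by simp_all
  have E: "hedges F \<subseteq> hverts F \<times> hverts F" "hedges F' \<subseteq> hverts F' \<times> hverts F'"
    and I: "\<And>h. h \<in> halfs F \<Longrightarrow> incid F h \<in> hverts F"
    using assms(1,2) by (auto simp: wf_half_edge_graph_def)
  have "bij_betw \<phi> (hedges F `` {i}) (hedges F' `` {\<phi> i})"
  proof (rule bij_betw_imageI)
    show "inj_on \<phi> (hedges F `` {i})" using b(1) E(1) by (auto intro: inj_on_subset)
    show "\<phi> ` (hedges F `` {i}) = hedges F' `` {\<phi> i}"
    proof
      show "\<phi> ` (hedges F `` {i}) \<subseteq> hedges F' `` {\<phi> i}" using e E(1) by blast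
      show "hedges F' `` {\<phi> i} \<subseteq> \<phi> ` (hedges F `` {i})"
      proof
        fix y assume y: "y \<in> hedges F' `` {\<phi> i}"
        then have "y \<in> hverts F'" using E(2) by blast
        then obtain j where "j \<in> hverts F" "y = \<phi> j" using b(2) by blast
        then show "y \<in> \<phi> ` (hedges F `` {i})" using e[OF assms(4)] y by blast
      qed
    qed
  qed
  then show "(\<Sum>j\<in>hedges F `` {i}. g (\<phi> j)) = (\<Sum>y\<in>hedges F' `` {\<phi> i}. g y)"
    by (rule sum.reindex_bij_betw)
  have "bij_betw \<psi> {h. h \<in> halfs F \<and> incid F h = i} {k. k \<in> halfs F' \<and> incid F' k = \<phi> i}"
  proof (rule bij_betw_imageI)
    show "inj_on \<psi> {h. h \<in> halfs F \<and> incid F h = i}" using b(3) by (auto intro: inj_on_subset)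
    show "\<psi> ` {h. h \<in> halfs F \<and> incid F h = i} = {k. k \<in> halfs F' \<and> incid F' k = \<phi> i}"
    proof
      show "\<psi> ` {h. h \<in> halfs F \<and> incid F h = i} \<subseteq> {k. k \<in> halfs F' \<and> incid F' k = \<phi> i}"
        using b(4) i by auto
      show "{k. k \<in> halfs F' \<and> incid F' k = \<phi> i} \<subseteq> \<psi> ` {h. h \<in> halfs F \<and> incid F h = i}"
      proof
        fix k assume k: "k \<in> {k. k \<in> halfs F' \<and> incid F' k = \<phi> i}"
        then obtain h where h: "h \<in> halfs F" "k = \<psi> h" using b(4) by blast
        then have "\<phi> (incid F h) = \<phi> i" using i k by simp
        then have "incid F h = i" using inj_onD[OF b(1)] I[OF h(1)] assms(4) by blast
        then show "k \<in> \<psi> ` {h. h \<in> halfs F \<and> incid F h = i}" using h by blast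
      qed
    qed
  qed
  then show "(\<Sum>h | h \<in> halfs F \<and> incid F h = i. g' (\<psi> h)) = (\<Sum>k | k \<in> halfs F' \<and> incid F' k = \<phi> i. g' k)"
    by (rule sum.reindex_bij_betw)
qed

text \<open>A neighbour of \<open>x\<close> outside \<open>S\<close> is the same thing as a
  half-edge at \<open>x\<close>, so the sum at \<open>x\<close> can be computed in the graph with
  half-edges of the tile.\<close>

lemma half_nbhd_sum:
  assumes "x \<in> S" and "finite (G `` {x})"
  shows "(\<Sum>y\<in>G `` {x}. g y) = (\<Sum>y\<in>hedges (half_nbhd G S) `` {x}. g y) +
    (\<Sum>k | k \<in> halfs (half_nbhd G S) \<and> incid (half_nbhd G S) k = x. g (snd k))"
proof -
  have "(\<Sum>y\<in>G `` {x}. g y) = (\<Sum>y\<in>G `` {x} \<inter> S. g y) + (\<Sum>y\<in>G `` {x} - S. g y)"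
    using assms(2) by (rule sum.Int_Diff)
  moreover have "G `` {x} \<inter> S = hedges (half_nbhd G S) `` {x}"
    using assms(1) by (auto simp: half_nbhd_def)
  moreover have "(\<Sum>k | k \<in> halfs (half_nbhd G S) \<and> incid (half_nbhd G S) k = x. g (snd k)) = (\<Sum>y\<in>G `` {x} - S. g y)"
    using assms(1)
    by (intro sum.reindex_bij_witness[where i = "\<lambda>y. (x, y)" and j = snd]) (auto simp: half_nbhd_def)
  ultimately show ?thesis by simp
qed

text \<open>Averaging over all isomorphisms from \<open>F\<close> makes the weights invariant under automorphisms;
  by half-edge transitivity all half-edges then carry the same weight.\<close>

lemma invariant_weights:
  fixes F :: "('v, 'h) half_edge_graph" and K :: "('w, 'k) half_edge_graph"
    and a :: "'w \<Rightarrow> 'w \<Rightarrow> real" and b :: "'k \<Rightarrow> real"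
  assumes fin: "finite_half_edge_graph F" and trans: "half_edge_transitive F"
    and iso: "half_edge_graph_iso \<phi>0 \<psi>0 F K" and K: "wf_half_edge_graph K"
    and a: "\<And>x y. 0 \<le> a x y" "\<And>x y. a x y = a y x" and b: "\<And>k. 0 \<le> b k"
    and one: "\<And>x. x \<in> hverts K \<Longrightarrow>
      (\<Sum>y\<in>hedges K `` {x}. a x y) + (\<Sum>k | k \<in> halfs K \<and> incid K k = x. b k) = 1"
  obtains E :: "'v \<Rightarrow> 'v \<Rightarrow> real" and c :: real where
    "\<And>i j. 0 \<le> E i j" "\<And>i j. E i j = E j i" "0 \<le> c"
    "\<And>\<alpha> \<beta> i j. half_edge_graph_iso \<alpha> \<beta> F F \<Longrightarrow> i \<in> hverts F \<Longrightarrow> j \<in> hverts F \<Longrightarrow> E (\<alpha> i) (\<alpha> j) = E i j"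
    "\<And>i. i \<in> hverts F \<Longrightarrow>
      (\<Sum>j\<in>hedges F `` {i}. E i j) + (\<Sum>h | h \<in> halfs F \<and> incid F h = i. c) = 1"
proof -
  let ?V = "hverts F" and ?H = "halfs F"
  have F: "wf_half_edge_graph F" and finV: "finite ?V" and finH: "finite ?H"
    using fin by (auto simp: finite_half_edge_graph_def wf_half_edge_graph_def graph_on_def)
  define Is where "Is = {p \<in> (?V \<rightarrow>\<^sub>E hverts K) \<times> (?H \<rightarrow>\<^sub>E halfs K). half_edge_graph_iso (fst p) (snd p) F K}"
  have mem: "(restrict \<phi> ?V, restrict \<psi> ?H) \<in> Is" if "half_edge_graph_iso \<phi> \<psi> F K" for \<phi> \<psi>
    using half_edge_graph_iso_restrict[OF F that] that
    by (auto simp: Is_def half_edge_graph_iso_def bij_betw_def)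
  have finIs: "finite Is"
  proof -
    have "finite (hverts K)" "finite (halfs K)"
      using iso finV finH by (auto simp: half_edge_graph_iso_def dest: bij_betw_finite)
    then have "finite ((?V \<rightarrow>\<^sub>E hverts K) \<times> (?H \<rightarrow>\<^sub>E halfs K))" using finV finH by (simp add: finite_PiE)
    then show ?thesis by (rule rev_finite_subset) (auto simp: Is_def)
  qed
  define n where "n = real (card Is)"
  have n: "0 < n" using mem[OF iso] finIs by (auto simp: n_def card_gt_0_iff)
  define E where "E = (\<lambda>i j. (\<Sum>p\<in>Is. a (fst p i) (fst p j)) / n)"
  define B where "B = (\<lambda>h. (\<Sum>p\<in>Is. b (snd p h)) / n)"
  have aut: "E (\<alpha> i) (\<alpha> j) = E i j" "h \<in> ?H \<Longrightarrow> B (\<beta> h) = B h"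
    if ab: "half_edge_graph_iso \<alpha> \<beta> F F" and ij: "i \<in> ?V" "j \<in> ?V" for \<alpha> \<beta> i j h
  proof -
    \<comment> \<open>Precomposition with the automorphism permutes \<open>Is\<close>, so it merely
      reorders the sums behind the averages.\<close>
    define T where "T = (\<lambda>p::('v \<Rightarrow> 'w) \<times> ('h \<Rightarrow> 'k).
      (restrict (\<lambda>x. fst p (\<alpha> x)) ?V, restrict (\<lambda>h. snd p (\<beta> h)) ?H))"
    have im: "\<alpha> ` ?V = ?V" "\<beta> ` ?H = ?H" using ab by (auto simp: half_edge_graph_iso_def bij_betw_def)
    have "T ` Is \<subseteq> Is"
    proof (rule image_subsetI)
      fix p assume "p \<in> Is"
      then show "T p \<in> Is" unfolding T_def
        by (intro mem half_edge_graph_iso_trans[OF F ab]) (simp add: Is_def)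
    qed
    moreover have "inj_on T Is"
    proof (rule inj_onI)
      fix p q assume p: "p \<in> Is" and q: "q \<in> Is" and eq: "T p = T q"
      have "fst p (\<alpha> x) = fst q (\<alpha> x)" if "x \<in> ?V" for x
        using arg_cong[OF eq, of "\<lambda>r. fst r x"] that by (simp add: T_def)
      then have "fst p y = fst q y" if "y \<in> ?V" for y
        using that im(1) by (metis (no_types, lifting) imageE)
      then have "fst p = fst q"
        using p q by (intro PiE_ext[of _ ?V "\<lambda>_. hverts K"]) (auto simp: Is_def)
      moreover have "snd p (\<beta> h) = snd q (\<beta> h)" if "h \<in> ?H" for h
        using arg_cong[OF eq, of "\<lambda>r. snd r h"] that by (simp add: T_def)
      then have "snd p k = snd q k" if "k \<in> ?H" for k
        using that im(2) by (metis (no_types, lifting) imageE)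
      then have "snd p = snd q"
        using p q by (intro PiE_ext[of _ ?H "\<lambda>_. halfs K"]) (auto simp: Is_def)
      ultimately show "p = q" by (simp add: prod_eq_iff)
    qed
    ultimately have bij: "bij_betw T Is Is"
      unfolding bij_betw_def using endo_inj_surj[OF finIs] by blast
    show "E (\<alpha> i) (\<alpha> j) = E i j"
      using sum.reindex_bij_betw[OF bij, of "\<lambda>p. a (fst p i) (fst p j)"] ij by (simp add: E_def T_def)
    show "B (\<beta> h) = B h" if "h \<in> ?H"
      using sum.reindex_bij_betw[OF bij, of "\<lambda>p. b (snd p h)"] that by (simp add: B_def T_def)
  qed
  \<comment> \<open>Any half-edge can serve as the reference, as transitivity gives all of them the
    same average; 0 is the default if there is none.\<close>
  define c where "c = (if ?H = {} then 0 else B (SOME h. h \<in> ?H))"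
  have Bc: "B h = c" if h: "h \<in> ?H" for h
  proof -
    define h0 where "h0 = (SOME h. h \<in> ?H)"
    have h0: "h0 \<in> ?H" using h unfolding h0_def by (rule someI)
    obtain \<alpha> \<beta> where "half_edge_graph_iso \<alpha> \<beta> F F" "\<beta> h0 = h"
      using trans h h0 unfolding half_edge_transitive_def by blast
    \<comment> \<open>The fact \<open>aut\<close> also asks for two vertices; the endpoint of
      \<open>h\<close> supplies both.\<close>
    moreover have "incid F h \<in> ?V" using F h by (auto simp: wf_half_edge_graph_def)
    ultimately have "B h = B h0" using aut(2)[of \<alpha> \<beta> "incid F h" "incid F h" h0] h0 by blast
    then show ?thesis using h by (auto simp: c_def h0_def)
  qed
  show ?thesis
  proof
    show "0 \<le> E i j" for i j using a(1) n by (simp add: E_def sum_nonneg)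
    show "E i j = E j i" for i j using a(2) by (simp add: E_def)
    show "0 \<le> c" using b n by (simp add: c_def B_def sum_nonneg)
    show "E (\<alpha> i) (\<alpha> j) = E i j" if "half_edge_graph_iso \<alpha> \<beta> F F" "i \<in> ?V" "j \<in> ?V" for \<alpha> \<beta> i j
      using aut(1) that by blast
    fix i assume i: "i \<in> ?V"
    have E_sum: "(\<Sum>j\<in>hedges F `` {i}. E i j) = (\<Sum>p\<in>Is. \<Sum>j\<in>hedges F `` {i}. a (fst p i) (fst p j)) / n"
      unfolding E_def sum_divide_distrib[symmetric] by (subst sum.swap) simp
    have B_sum: "(\<Sum>h | h \<in> ?H \<and> incid F h = i. B h)
        = (\<Sum>p\<in>Is. \<Sum>h | h \<in> ?H \<and> incid F h = i. b (snd p h)) / n"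
      unfolding B_def sum_divide_distrib[symmetric] by (subst sum.swap) simp
    have "(\<Sum>j\<in>hedges F `` {i}. E i j) + (\<Sum>h | h \<in> ?H \<and> incid F h = i. c)
        = (\<Sum>j\<in>hedges F `` {i}. E i j) + (\<Sum>h | h \<in> ?H \<and> incid F h = i. B h)"
      using Bc by simp
    also have "\<dots> = (\<Sum>p\<in>Is. (\<Sum>j\<in>hedges F `` {i}. a (fst p i) (fst p j))
            + (\<Sum>h | h \<in> ?H \<and> incid F h = i. b (snd p h))) / n"
      unfolding E_sum B_sum by (simp add: sum.distrib add_divide_distrib)
    \<comment> \<open>Each isomorphism in \<open>Is\<close> turns its summand into a vertex sum of
      \<open>K\<close>, which is 1.\<close>
    also have "\<dots> = (\<Sum>p\<in>Is. 1) / n"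
    proof (intro arg_cong[where f = "\<lambda>s. s / n"] sum.cong refl)
      fix p assume "p \<in> Is"
      then have p: "half_edge_graph_iso (fst p) (snd p) F K" by (simp add: Is_def)
      have "fst p i \<in> hverts K" using p i by (auto simp: half_edge_graph_iso_def bij_betw_def)
      then show "(\<Sum>j\<in>hedges F `` {i}. a (fst p i) (fst p j))
            + (\<Sum>h | h \<in> ?H \<and> incid F h = i. b (snd p h)) = 1"
        using one half_edge_graph_iso_sum(1)[OF F K p i, of "a (fst p i)"]
          half_edge_graph_iso_sum(2)[OF F K p i, of b] by simp
    qed
    also have "\<dots> = 1" using n by (simp add: n_def)
    finally show "(\<Sum>j\<in>hedges F `` {i}. E i j) + (\<Sum>h | h \<in> ?H \<and> incid F h = i. c) = 1" .
  qed
qed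

section \<open>Tiles\<close>

text \<open>A code of a tile lists its vertices along \<open>hverts F\<close> and the outer endpoints of its half-edges
  along \<open>halfs F\<close>. Only the presence of the listed half-edges is demanded; that there are no others
  follows by counting.\<close>

definition tile_code :: "'a rel \<Rightarrow> 'a set set \<Rightarrow> ('v, 'h) half_edge_graph \<Rightarrow> ('v + 'h \<Rightarrow> 'a) \<Rightarrow> bool" where
  "tile_code G \<T> F w \<longleftrightarrow>
     inj_on (\<lambda>i. w (Inl i)) (hverts F) \<and> (\<lambda>i. w (Inl i)) ` hverts F \<in> \<T> \<and>
     (\<forall>i\<in>hverts F. \<forall>j\<in>hverts F. (i, j) \<in> hedges F \<longleftrightarrow> (w (Inl i), w (Inl j)) \<in> G) \<and>
     (\<forall>h\<in>halfs F. (w (Inl (incid F h)), w (Inr h)) \<in> G) \<and>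
     (\<forall>h\<in>halfs F. \<forall>i\<in>hverts F. w (Inr h) \<noteq> w (Inl i)) \<and>
     (\<forall>h\<in>halfs F. \<forall>k\<in>halfs F. h \<noteq> k \<and> incid F h = incid F k \<longrightarrow> w (Inr h) \<noteq> w (Inr k))"

lemma tile_code_iso:
  assumes "finite_half_edge_graph F" and "tile_code G \<T> F w"
    and "half_edge_graph_isomorphic (half_nbhd G ((\<lambda>i. w (Inl i)) ` hverts F)) F"
  shows "half_edge_graph_iso (\<lambda>i. w (Inl i)) (\<lambda>h. (w (Inl (incid F h)), w (Inr h))) F
    (half_nbhd G ((\<lambda>i. w (Inl i)) ` hverts F))"
proof -
  let ?S = "(\<lambda>i. w (Inl i)) ` hverts F" and ?\<psi> = "\<lambda>h. (w (Inl (incid F h)), w (Inr h))"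
  have F: "finite (halfs F)" "\<And>h. h \<in> halfs F \<Longrightarrow> incid F h \<in> hverts F"
    using assms(1) by (auto simp: finite_half_edge_graph_def)
  have inj: "inj_on (\<lambda>i. w (Inl i)) (hverts F)"
    and edges: "\<And>i j. i \<in> hverts F \<Longrightarrow> j \<in> hverts F \<Longrightarrow> (i, j) \<in> hedges F \<longleftrightarrow> (w (Inl i), w (Inl j)) \<in> G"
    and half: "\<And>h. h \<in> halfs F \<Longrightarrow> (w (Inl (incid F h)), w (Inr h)) \<in> G"
    and out: "\<And>h i. h \<in> halfs F \<Longrightarrow> i \<in> hverts F \<Longrightarrow> w (Inr h) \<noteq> w (Inl i)"
    and dist: "\<And>h k. h \<in> halfs F \<Longrightarrow> k \<in> halfs F \<Longrightarrow> h \<noteq> k \<Longrightarrow> incid F h = incid F k \<Longrightarrow> w (Inr h) \<noteq> w (Inr k)"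
    using assms(2) unfolding tile_code_def by simp_all
  \<comment> \<open>This bijection is unrelated to \<open>w\<close>; only the equality of the finite
    numbers of half-edges is taken from it, to make the injection \<open>?\<psi>\<close>
    onto.\<close>
  obtain \<psi> where \<psi>: "bij_betw \<psi> (halfs (half_nbhd G ?S)) (halfs F)"
    using assms(3) unfolding half_edge_graph_isomorphic_def half_edge_graph_iso_def by blast
  have inj': "inj_on ?\<psi> (halfs F)"
  proof (rule inj_onI)
    fix h k assume hk: "h \<in> halfs F" "k \<in> halfs F" "?\<psi> h = ?\<psi> k"
    then have "incid F h = incid F k" using inj_onD[OF inj, of "incid F h" "incid F k"] F(2) by simp
    then show "h = k" using dist[OF hk(1,2)] hk(3) by blast
  qed
  have "?\<psi> ` halfs F \<subseteq> halfs (half_nbhd G ?S)"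
    using half out F(2) by (auto simp: half_nbhd_def)
  moreover have "finite (halfs (half_nbhd G ?S))" using bij_betw_finite[OF \<psi>] F(1) by simp
  moreover have "card (?\<psi> ` halfs F) = card (halfs (half_nbhd G ?S))"
    using card_image[OF inj'] bij_betw_same_card[OF \<psi>] by simp
  ultimately have "?\<psi> ` halfs F = halfs (half_nbhd G ?S)" by (metis card_subset_eq)
  then have "bij_betw ?\<psi> (halfs F) (halfs (half_nbhd G ?S))" using inj' by (simp add: bij_betw_def)
  moreover have "bij_betw (\<lambda>i. w (Inl i)) (hverts F) (hverts (half_nbhd G ?S))"
    using inj by (simp add: bij_betw_def half_nbhd_def)
  ultimately show ?thesis
    unfolding half_edge_graph_iso_def using edges by (simp add: half_nbhd_def)
qed

lemma tile_code_exists: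
  assumes "finite_half_edge_graph F" and "S \<in> \<T>" and "S \<subseteq> space M" and "G \<subseteq> space M \<times> space M"
    and iso: "half_edge_graph_iso \<phi> \<psi> (half_nbhd G S) F"
  obtains w where "w \<in> space (\<Pi>\<^sub>M p\<in>Inl ` hverts F \<union> Inr ` halfs F. M)" "tile_code G \<T> F w"
    "\<forall>x\<in>S. w (Inl (\<phi> x)) = x" "\<forall>(x, y)\<in>halfs (half_nbhd G S). w (Inr (\<psi> (x, y))) = y"
proof -
  let ?K = "half_nbhd G S"
  define \<phi>' where "\<phi>' = inv_into S \<phi>"
  define \<psi>' where "\<psi>' = inv_into (halfs ?K) \<psi>"
  \<comment> \<open>The code is the inverse isomorphism. A half-edge is recorded by its outer
    endpoint alone, as its inner one is a listed vertex; \<open>restrict\<close> makes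
    \<open>w\<close> a point of the product space.\<close>
  define w where "w = restrict (case_sum \<phi>' (\<lambda>h. snd (\<psi>' h))) (Inl ` hverts F \<union> Inr ` halfs F)"
  have F: "wf_half_edge_graph F"
    using assms(1) by (auto simp: finite_half_edge_graph_def wf_half_edge_graph_def graph_on_def)
  have b: "bij_betw \<phi> S (hverts F)" "bij_betw \<psi> (halfs ?K) (halfs F)"
    using iso by (simp_all add: half_edge_graph_iso_def half_nbhd_def)
  have "half_edge_graph_iso \<phi>' \<psi>' F ?K"
    using half_edge_graph_iso_inv[OF wf_half_edge_graph_half_nbhd iso]
    by (simp add: \<phi>'_def \<psi>'_def half_nbhd_def)
  then have b': "bij_betw \<phi>' (hverts F) S" "bij_betw \<psi>' (halfs F) (halfs ?K)"
    and e: "\<And>i j. i \<in> hverts F \<Longrightarrow> j \<in> hverts F \<Longrightarrow> (i, j) \<in> hedges F \<longleftrightarrow> (\<phi>' i, \<phi>' j) \<in> G \<inter> S \<times> S"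
    and i: "\<And>h. h \<in> halfs F \<Longrightarrow> fst (\<psi>' h) = \<phi>' (incid F h)"
    unfolding half_edge_graph_iso_def by (simp_all add: half_nbhd_def)
  have wl: "w (Inl i) = \<phi>' i" if "i \<in> hverts F" for i using that by (simp add: w_def)
  have wr: "w (Inr h) = snd (\<psi>' h)" if "h \<in> halfs F" for h using that by (simp add: w_def)
  have I: "incid F h \<in> hverts F" if "h \<in> halfs F" for h using F that by (auto simp: wf_half_edge_graph_def)
  have \<phi>'S: "\<phi>' i \<in> S" if "i \<in> hverts F" for i using b'(1) that by (rule bij_betw_apply)
  have \<psi>'K: "\<psi>' h \<in> G \<inter> S \<times> (- S)" if "h \<in> halfs F" for h
    using bij_betw_apply[OF b'(2) that] by (simp add: half_nbhd_def)
  have pair: "(\<phi>' (incid F h), snd (\<psi>' h)) = \<psi>' h" if "h \<in> halfs F" for h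
    using i[OF that] by (metis prod.collapse)
  have img: "(\<lambda>i. w (Inl i)) ` hverts F = S"
    using b'(1) wl by (auto simp: bij_betw_def image_iff)
  show ?thesis
  proof
    show "w \<in> space (\<Pi>\<^sub>M p\<in>Inl ` hverts F \<union> Inr ` halfs F. M)"
      using \<phi>'S \<psi>'K assms(3,4) by (fastforce simp: space_PiM w_def)
    show "tile_code G \<T> F w"
      unfolding tile_code_def
    proof (intro conjI ballI impI)
      show "inj_on (\<lambda>i. w (Inl i)) (hverts F)"
        using b'(1) wl by (auto simp: bij_betw_def inj_on_def)
      show "(\<lambda>i. w (Inl i)) ` hverts F \<in> \<T>" using img assms(2) by simp
      show "(i, j) \<in> hedges F \<longleftrightarrow> (w (Inl i), w (Inl j)) \<in> G" if "i \<in> hverts F" "j \<in> hverts F" for i j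
        using e that wl \<phi>'S by simp
      show "(w (Inl (incid F h)), w (Inr h)) \<in> G" if "h \<in> halfs F" for h
        using that wl wr I pair \<psi>'K[OF that] by simp
      show "w (Inr h) \<noteq> w (Inl i)" if "h \<in> halfs F" "i \<in> hverts F" for h i
        using that wl wr \<phi>'S[OF that(2)] \<psi>'K[OF that(1)] by auto
      show "w (Inr h) \<noteq> w (Inr k)" if "h \<in> halfs F" "k \<in> halfs F" "h \<noteq> k \<and> incid F h = incid F k" for h k
      proof
        assume "w (Inr h) = w (Inr k)"
        then have "snd (\<psi>' h) = snd (\<psi>' k)" using wr[OF that(1)] wr[OF that(2)] by simp
        moreover have "fst (\<psi>' h) = fst (\<psi>' k)" using i[OF that(1)] i[OF that(2)] that(3) by simp
        ultimately have "\<psi>' h = \<psi>' k" by (simp add: prod_eq_iff)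
        then show False
          using inj_onD[OF bij_betw_imp_inj_on[OF b'(2)] _ that(1,2)] that(3) by blast
      qed
    qed
    have "w (Inl (\<phi> x)) = x" if "x \<in> S" for x
      using b(1) that wl[of "\<phi> x"] bij_betw_apply[OF b(1) that] by (simp add: \<phi>'_def bij_betw_inv_into_left)
    then show "\<forall>x\<in>S. w (Inl (\<phi> x)) = x" by blast
    have "w (Inr (\<psi> (x, y))) = y" if k: "(x, y) \<in> halfs ?K" for x y
    proof -
      have "\<psi>' (\<psi> (x, y)) = (x, y)" using b(2) k by (simp add: \<psi>'_def bij_betw_inv_into_left)
      then show ?thesis using wr bij_betw_apply[OF b(2) k] by simp
    qed
    then show "\<forall>(x, y)\<in>halfs ?K. w (Inr (\<psi> (x, y))) = y" by blast
  qed
qed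

text \<open>Each clause of a code is a finite Boolean combination of preimages of \<open>G\<close>,
  of the diagonal or of \<open>\<T>\<close> under coordinate maps.\<close>

lemma sets_tile_code:
  fixes F :: "('v, 'h) half_edge_graph"
  assumes F: "finite_half_edge_graph F" and T: "\<T> \<in> sets (finite_subsets_space M)"
    and G: "G \<in> sets (M \<Otimes>\<^sub>M M)" and M: "countably_separated M"
  shows "{w \<in> space (\<Pi>\<^sub>M p\<in>Inl ` hverts F \<union> Inr ` halfs F. M). tile_code G \<T> F w}
    \<in> sets (\<Pi>\<^sub>M p\<in>Inl ` hverts F \<union> Inr ` halfs F. M)"
proof -
  let ?J = "Inl ` hverts F \<union> Inr ` halfs F :: ('v + 'h) set"
  let ?W = "\<Pi>\<^sub>M p\<in>?J. M"
  have fin: "finite (hverts F)" "finite (halfs F)" and I: "\<And>h. h \<in> halfs F \<Longrightarrow> incid F h \<in> hverts F"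
    using F by (auto simp: finite_half_edge_graph_def)
  have comp: "(\<lambda>w. w p) \<in> ?W \<rightarrow>\<^sub>M M" if "p \<in> ?J" for p using that by (rule measurable_component_singleton)
  have pair: "{w \<in> space ?W. (w p, w q) \<in> R} \<in> sets ?W"
    if "p \<in> ?J" "q \<in> ?J" "R \<in> sets (M \<Otimes>\<^sub>M M)" for p q R
    using measurable_sets[OF measurable_Pair[OF comp[OF that(1)] comp[OF that(2)]] that(3)]
    by (simp add: vimage_def Int_def conj_commute)
  have neq: "{w \<in> space ?W. w p \<noteq> w q} \<in> sets ?W" if "p \<in> ?J" "q \<in> ?J" for p q
  proof -
    have "{w \<in> space ?W. w p \<noteq> w q} =
        space ?W - {w \<in> space ?W. (w p, w q) \<in> {r \<in> space (M \<Otimes>\<^sub>M M). fst r = snd r}}"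
      using measurable_space[OF comp[OF that(1)]] measurable_space[OF comp[OF that(2)]]
      by (auto simp: space_pair_measure)
    then show ?thesis using pair[OF that countably_separated_diagonal[OF M]] by simp
  qed
  \<comment> \<open>The \<sigma>-algebra on finite sets is described by tuples indexed by
    \<open>{..<n}\<close>, so the vertices of \<open>F\<close> have to be numbered before
    \<open>\<T>\<close> can be pulled back.\<close>
  obtain v n where v: "bij_betw v {..<n::nat} (hverts F)"
    using ex_bij_betw_nat_finite[OF fin(1)] by (auto simp: atLeast0LessThan)
  have vJ: "Inl (v k) \<in> ?J" if "k < n" for k using v that by (auto simp: bij_betw_def)
  have "{w \<in> space ?W. (\<lambda>i. w (Inl i)) ` hverts F \<in> \<T>} \<in> sets ?W"
  proof -
    let ?t = "\<lambda>w. \<lambda>k\<in>{..<n}. w (Inl (v k))"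
    have t: "?t \<in> ?W \<rightarrow>\<^sub>M (\<Pi>\<^sub>M k\<in>{..<n}. M)" by (intro measurable_restrict comp vJ) simp
    have "{x \<in> space (\<Pi>\<^sub>M k\<in>{..<n}. M). x ` {..<n} \<in> \<T>} \<in> sets (\<Pi>\<^sub>M k\<in>{..<n}. M)"
      using T by (simp add: sets_finite_subsets_space)
    from measurable_sets[OF t this]
    have "{w \<in> space ?W. ?t w ` {..<n} \<in> \<T>} \<in> sets ?W"
      using measurable_space[OF t] by (simp add: vimage_def Int_def conj_commute cong: conj_cong)
    moreover have "?t w ` {..<n} = (\<lambda>i. w (Inl i)) ` hverts F" for w :: "'v + 'h \<Rightarrow> 'a"
      unfolding bij_betw_imp_surj_on[OF v, symmetric] by (simp add: image_image)
    ultimately show ?thesis by simp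
  qed
  moreover have "{w \<in> space ?W. inj_on (\<lambda>i. w (Inl i)) (hverts F)} \<in> sets ?W"
  proof -
    have "{w \<in> space ?W. \<forall>i\<in>hverts F. \<forall>j\<in>hverts F. i \<noteq> j \<longrightarrow> w (Inl i) \<noteq> w (Inl j)} \<in> sets ?W"
      by (intro sets.sets_Collect_finite_All fin sets.sets_Collect_imp sets.sets_Collect_const neq) auto
    moreover have "inj_on (\<lambda>i. w (Inl i)) (hverts F) \<longleftrightarrow>
        (\<forall>i\<in>hverts F. \<forall>j\<in>hverts F. i \<noteq> j \<longrightarrow> w (Inl i) \<noteq> w (Inl j))" for w :: "'v + 'h \<Rightarrow> 'a"
      unfolding inj_on_def by blast
    ultimately show ?thesis by (simp only:)
  qed
  moreover have "{w \<in> space ?W. \<forall>i\<in>hverts F. \<forall>j\<in>hverts F.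
      (i, j) \<in> hedges F \<longleftrightarrow> (w (Inl i), w (Inl j)) \<in> G} \<in> sets ?W"
    unfolding iff_conv_conj_imp
    by (intro sets.sets_Collect_finite_All fin sets.sets_Collect_conj sets.sets_Collect_imp
        sets.sets_Collect_const pair G) auto
  moreover have "{w \<in> space ?W. \<forall>h\<in>halfs F. (w (Inl (incid F h)), w (Inr h)) \<in> G} \<in> sets ?W"
    by (intro sets.sets_Collect_finite_All fin pair G) (auto intro: I)
  moreover have "{w \<in> space ?W. \<forall>h\<in>halfs F. \<forall>i\<in>hverts F. w (Inr h) \<noteq> w (Inl i)} \<in> sets ?W"
    by (intro sets.sets_Collect_finite_All fin neq) auto
  moreover have "{w \<in> space ?W. \<forall>h\<in>halfs F. \<forall>k\<in>halfs F.
      h \<noteq> k \<and> incid F h = incid F k \<longrightarrow> w (Inr h) \<noteq> w (Inr k)} \<in> sets ?W"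
    by (intro sets.sets_Collect_finite_All fin sets.sets_Collect_imp sets.sets_Collect_const neq) auto
  ultimately show ?thesis
    unfolding tile_code_def by (intro sets.sets_Collect_conj)
qed

section \<open>Construction of the fractional perfect matching\<close>

theorem theorem1p3:
  fixes M :: "'a measure" and G :: "'a rel"
  assumes "standard_borel_space M"
    and "borel_graph M G"
    and "locally_finite_graph (space M) G"
    and "bipartite_graph (space M) G"
    and "hall_condition (space M) G"
    and "borel_symmetrically_tileable M G"
  shows "\<exists>f. borel_fractional_perfect_matching M G f"
proof (cases "space M = {}")
  \<comment> \<open>An empty space is not an image of the Baire space and has to be treated
    apart.\<close>
  case True
  then have "G = {}" using assms(2) by (auto simp: borel_graph_def graph_on_def)
  then have "borel_fractional_perfect_matching M G (\<lambda>_. 0)"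
    using True by (simp add: borel_fractional_perfect_matching_def)
  then show ?thesis by blast
next
  case False
  have G: "G \<subseteq> space M \<times> space M" "sym G" "G \<in> sets (M \<Otimes>\<^sub>M M)"
    using assms(2) by (auto simp: borel_graph_def graph_on_def)
  have finG: "finite (G `` {x})" if "x \<in> space M" for x
    using assms(3) that by (simp add: locally_finite_graph_def)
  obtain F :: "(nat, nat) half_edge_graph" and \<T> where
    fin: "finite_half_edge_graph F" and trans: "half_edge_transitive F"
    and \<T>: "\<T> \<in> sets (finite_subsets_space M)" "disjoint \<T>" "\<Union>\<T> = space M"
    and iso: "\<And>S. S \<in> \<T> \<Longrightarrow> half_edge_graph_isomorphic (half_nbhd G S) F"
    using assms(6) unfolding borel_symmetrically_tileable_def borel_tileable_def by blast
  have F: "wf_half_edge_graph F"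
    using fin by (auto simp: finite_half_edge_graph_def wf_half_edge_graph_def graph_on_def)
  note K = wf_half_edge_graph_half_nbhd
  have "\<exists>\<phi> \<psi>. half_edge_graph_iso \<phi> \<psi> (half_nbhd G S) F" if "S \<in> \<T>" for S
    using iso[OF that] unfolding half_edge_graph_isomorphic_def .
  \<comment> \<open>A choice without any measurability: nothing relates the identifications of
    different tiles.\<close>
  then obtain \<phi> \<psi> where \<phi>: "\<And>S. S \<in> \<T> \<Longrightarrow> half_edge_graph_iso (\<phi> S) (\<psi> S) (half_nbhd G S) F"
    by metis
  have "\<exists>S\<in>\<T>. x \<in> S" if "x \<in> space M" for x using \<T>(3) that by blast
  then obtain tile where tile: "\<And>x. x \<in> space M \<Longrightarrow> tile x \<in> \<T> \<and> x \<in> tile x" by metis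
  have tile_eq: "tile x = S" if "S \<in> \<T>" "x \<in> S" for x S
  proof (rule ccontr)
    assume neq: "tile x \<noteq> S"
    have "x \<in> space M" using that \<T>(3) by blast
    then have "tile x \<inter> S = {}" using tile that(1) neq by (intro disjointD[OF \<T>(2)]) auto
    then show False using tile[OF \<open>x \<in> space M\<close>] that(2) by blast
  qed
  have vert: "\<phi> S x \<in> hverts F" if "S \<in> \<T>" "x \<in> S" for S x
    using \<phi>[OF that(1)] that(2) by (auto simp: half_edge_graph_iso_def half_nbhd_def dest: bij_betw_apply)
  obtain x0 where "x0 \<in> space M" using False by blast
  \<comment> \<open>Weights on one tile suffice for all tiles, since all of them are copies of
    \<open>F\<close>.\<close>
  then obtain S0 where S0: "S0 \<in> \<T>" using tile by blast
  have S0': "finite S0" "S0 \<subseteq> space M" using S0 \<T>(1,3) by (auto simp: sets_finite_subsets_space)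
  obtain e :: "'a \<Rightarrow> 'a \<Rightarrow> real" where e: "\<And>x y. 0 \<le> e x y" "\<And>x y. e x y = e y x"
    "\<And>x. x \<in> S0 \<Longrightarrow> (\<Sum>y\<in>G `` {x}. e x y) = 1"
  proof (rule hall_weights_on_finite_set[OF G(2) S0'(1)])
    show "finite (G `` {x})" if "x \<in> S0" for x using finG S0'(2) that by blast
    show "card X \<le> card (G `` X)" if "X \<subseteq> S0" for X
      using assms(5) that S0' finite_subset[OF that] by (auto simp: hall_condition_def)
  qed blast
  obtain E c where E: "\<And>i j. 0 \<le> E i j" "\<And>i j. E i j = E j i" "0 \<le> (c::real)"
    "\<And>\<alpha> \<beta> i j. half_edge_graph_iso \<alpha> \<beta> F F \<Longrightarrow> i \<in> hverts F \<Longrightarrow> j \<in> hverts F \<Longrightarrow> E (\<alpha> i) (\<alpha> j) = E i j"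
    "\<And>i. i \<in> hverts F \<Longrightarrow> (\<Sum>j\<in>hedges F `` {i}. E i j) + (\<Sum>h | h \<in> halfs F \<and> incid F h = i. c) = 1"
  \<comment> \<open>A half-edge of \<open>S0\<close> is weighted like the edge of \<open>G\<close>
    that it comes from.\<close>
  proof (rule invariant_weights[OF fin trans half_edge_graph_iso_inv[OF K \<phi>[OF S0]] K,
        where a = e and b = "\<lambda>k. e (fst k) (snd k)"])
    fix x assume "x \<in> hverts (half_nbhd G S0)"
    then have x: "x \<in> S0" by (simp add: half_nbhd_def)
    have "(\<Sum>y\<in>G `` {x}. e x y) = (\<Sum>y\<in>hedges (half_nbhd G S0) `` {x}. e x y) +
        (\<Sum>k | k \<in> halfs (half_nbhd G S0) \<and> incid (half_nbhd G S0) k = x. e x (snd k))"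
      using x S0'(2) by (intro half_nbhd_sum finG) auto
    also have "(\<Sum>k | k \<in> halfs (half_nbhd G S0) \<and> incid (half_nbhd G S0) k = x. e x (snd k)) =
        (\<Sum>k | k \<in> halfs (half_nbhd G S0) \<and> incid (half_nbhd G S0) k = x. e (fst k) (snd k))"
      by (intro sum.cong) (auto simp: half_nbhd_def)
    finally show "(\<Sum>y\<in>hedges (half_nbhd G S0) `` {x}. e x y) +
        (\<Sum>k | k \<in> halfs (half_nbhd G S0) \<and> incid (half_nbhd G S0) k = x. e (fst k) (snd k)) = 1"
      using e(3)[OF x] by simp
  qed (use e in blast)+
  define f where "f = (\<lambda>(x, y). if y \<in> tile x then E (\<phi> (tile x) x) (\<phi> (tile x) y) else c)"
  have f_in: "f (x, y) = E (\<phi> S x) (\<phi> S y)" if "S \<in> \<T>" "x \<in> S" "y \<in> S" for x y S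
    using tile_eq[OF that(1,2)] that by (simp add: f_def)
  have f_out: "f (x, y) = c" if "S \<in> \<T>" "x \<in> S" "y \<notin> S" for x y S
    using tile_eq[OF that(1,2)] that by (simp add: f_def)
  have f_nonneg: "0 \<le> f p" for p using E(1,3) by (auto simp: f_def split: prod.split)
  have f_sum: "(\<Sum>y\<in>G `` {x}. f (x, y)) = 1" if x: "x \<in> space M" for x
  proof -
    define S where "S = tile x"
    have S: "S \<in> \<T>" "x \<in> S" using tile[OF x] by (auto simp: S_def)
    let ?N = "half_nbhd G S"
    have xN: "x \<in> hverts ?N" using S(2) by (simp add: half_nbhd_def)
    have "(\<Sum>y\<in>G `` {x}. f (x, y)) = (\<Sum>y\<in>hedges ?N `` {x}. f (x, y)) +
        (\<Sum>k | k \<in> halfs ?N \<and> incid ?N k = x. f (x, snd k))"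
      using S(2) finG[OF x] by (rule half_nbhd_sum)
    also have "(\<Sum>y\<in>hedges ?N `` {x}. f (x, y)) = (\<Sum>y\<in>hedges ?N `` {x}. E (\<phi> S x) (\<phi> S y))"
      using f_in[OF S] by (intro sum.cong) (auto simp: half_nbhd_def)
    also have "\<dots> = (\<Sum>j\<in>hedges F `` {\<phi> S x}. E (\<phi> S x) j)"
      by (rule half_edge_graph_iso_sum(1)[OF K F \<phi>[OF S(1)] xN])
    also have "(\<Sum>k | k \<in> halfs ?N \<and> incid ?N k = x. f (x, snd k)) = (\<Sum>k | k \<in> halfs ?N \<and> incid ?N k = x. c)"
      using f_out[OF S] by (intro sum.cong) (auto simp: half_nbhd_def)
    also have "\<dots> = (\<Sum>h | h \<in> halfs F \<and> incid F h = \<phi> S x. c)"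
      by (rule half_edge_graph_iso_sum(2)[OF K F \<phi>[OF S(1)] xN])
    finally show ?thesis using E(5)[OF vert[OF S]] by simp
  qed
  have f_sym: "f (x, y) = f (y, x)" if "(x, y) \<in> G" for x y
  proof -
    have xy: "x \<in> space M" "y \<in> space M" using that G(1) by auto
    \<comment> \<open>Within one tile symmetry is that of \<open>E\<close>; between two tiles both
      orientations get \<open>c\<close>.\<close>
    have "y \<in> tile x \<longleftrightarrow> x \<in> tile y" using tile[OF xy(1)] tile[OF xy(2)] tile_eq by blast
    then show ?thesis
      using f_in[of "tile x" x y] f_in[of "tile x" y x] f_out[of "tile x" x y] f_out[of "tile y" y x]
        tile[OF xy(1)] tile[OF xy(2)] E(2) by (cases "y \<in> tile x") auto
  qed
  have f_le_one: "f (x, y) \<le> 1" if "(x, y) \<in> G" for x y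
  proof -
    have x: "x \<in> space M" using that G(1) by auto
    have "f (x, y) \<le> (\<Sum>y\<in>G `` {x}. f (x, y))"
      using that f_nonneg finG[OF x] by (intro member_le_sum[where f = "\<lambda>y. f (x, y)"]) auto
    then show ?thesis using f_sum[OF x] by simp
  qed
  let ?W = "\<Pi>\<^sub>M p\<in>Inl ` hverts F \<union> Inr ` halfs F. M"
  let ?Z = "{w \<in> space ?W. tile_code G \<T> F w}"
  \<comment> \<open>An index is a pair of coordinates of a code, taken at an edge or a half-edge of
    \<open>F\<close>. Reading a code there gives an oriented edge of \<open>G\<close> whose weight
    depends on the index alone.\<close>
  let ?I = "(\<lambda>(i, j). (Inl i, Inl j)) ` hedges F \<union> (\<lambda>h. (Inl (incid F h), Inr h)) ` halfs F"
  have M: "countably_separated M" using assms(1) by (rule standard_borel_space_countably_separated)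
  have EV: "i \<in> hverts F" "j \<in> hverts F" if "(i, j) \<in> hedges F" for i j
    using F that by (auto simp: wf_half_edge_graph_def)
  have IV: "incid F h \<in> hverts F" if "h \<in> halfs F" for h
    using F that by (auto simp: wf_half_edge_graph_def)
  have "f \<in> borel_measurable (restrict_space (M \<Otimes>\<^sub>M M) G)"
  proof (rule measurable_analytic_partition[where W = ?W and I = ?I and B = "\<lambda>_. ?Z"
        and g = "\<lambda>(p, q) w. (w p, w q)" and c = "\<lambda>(p, q). case q of Inl j \<Rightarrow> E (projl p) j | Inr _ \<Rightarrow> c"])
    show "baire_image_space ?W"
      using assms(1) False by (intro baire_image_space_PiM standard_borel_space_baire_image)
    show "countably_separated (M \<Otimes>\<^sub>M M)" using M by (intro countably_separated_pair)
    show "G \<in> sets (M \<Otimes>\<^sub>M M)" by (fact G(3))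
    show "countable ?I" by simp
    show "?Z \<in> sets ?W" using fin \<T>(1) G(3) M by (rule sets_tile_code)
    show "(case r of (p, q) \<Rightarrow> \<lambda>w. (w p, w q)) \<in> ?W \<rightarrow>\<^sub>M M \<Otimes>\<^sub>M M" if "r \<in> ?I" for r
      using that EV IV by (auto intro!: measurable_Pair measurable_component_singleton)
  next
    have "G \<subseteq> (\<Union>r\<in>?I. (case r of (p, q) \<Rightarrow> \<lambda>w. (w p, w q)) ` ?Z)"
    proof (rule subrelI)
      fix x y assume xy: "(x, y) \<in> G"
      define S where "S = tile x"
      have S: "S \<in> \<T>" "x \<in> S" using tile[of x] G(1) xy by (auto simp: S_def)
      have "S \<subseteq> space M" using S \<T>(3) by blast
      then obtain w where "w \<in> space ?W" "tile_code G \<T> F w"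
        and w: "\<forall>x\<in>S. w (Inl (\<phi> S x)) = x"
        "\<forall>(x, y)\<in>halfs (half_nbhd G S). w (Inr (\<psi> S (x, y))) = y"
        by (rule tile_code_exists[OF fin S(1) _ G(1) \<phi>[OF S(1)]])
      then have wZ: "w \<in> ?Z" by simp
      show "(x, y) \<in> (\<Union>r\<in>?I. (case r of (p, q) \<Rightarrow> \<lambda>w. (w p, w q)) ` ?Z)"
      proof (cases "y \<in> S")
        case True
        have "(\<phi> S x, \<phi> S y) \<in> hedges F"
          using \<phi>[OF S(1)] S(2) True xy by (auto simp: half_edge_graph_iso_def half_nbhd_def)
        then have "(Inl (\<phi> S x), Inl (\<phi> S y)) \<in> ?I" by force
        moreover have "(x, y) = (w (Inl (\<phi> S x)), w (Inl (\<phi> S y)))" using w(1) S(2) True by simp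
        ultimately show ?thesis          by (intro UN_I[of "(Inl (\<phi> S x), Inl (\<phi> S y))"] image_eqI[OF _ wZ]) simp_all
      next
        case False
        have k: "(x, y) \<in> halfs (half_nbhd G S)" using xy S(2) False by (simp add: half_nbhd_def)
        then have "\<psi> S (x, y) \<in> halfs F" "incid F (\<psi> S (x, y)) = \<phi> S x"
          using \<phi>[OF S(1)] by (auto simp: half_edge_graph_iso_def half_nbhd_def dest: bij_betw_apply)
        then have "(Inl (\<phi> S x), Inr (\<psi> S (x, y))) \<in> ?I" by force
        moreover have "(x, y) = (w (Inl (\<phi> S x)), w (Inr (\<psi> S (x, y))))" using w S(2) k by auto
        ultimately show ?thesis
          by (intro UN_I[of "(Inl (\<phi> S x), Inr (\<psi> S (x, y)))"] image_eqI[OF _ wZ]) simp_all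
      qed
    qed

    moreover have "(case r of (p, q) \<Rightarrow> \<lambda>w. (w p, w q)) w \<in> G" if r: "r \<in> ?I" and w: "w \<in> ?Z" for r w
    proof -
      have "tile_code G \<T> F w" using w by simp
      note code = this[unfolded tile_code_def]
      from r consider (edge) i j where "(i, j) \<in> hedges F" "r = (Inl i, Inl j)"
        | (half) h where "h \<in> halfs F" "r = (Inl (incid F h), Inr h)" by auto
      then show ?thesis
      proof cases
        case edge
        then show ?thesis using code EV[OF edge(1)] by simp
      next
        case half
        then show ?thesis using code by simp
      qed
    qed
    then have "(\<Union>r\<in>?I. (case r of (p, q) \<Rightarrow> \<lambda>w. (w p, w q)) ` ?Z) \<subseteq> G" by (intro UN_least image_subsetI)
    ultimately show "G = (\<Union>r\<in>?I. (case r of (p, q) \<Rightarrow> \<lambda>w. (w p, w q)) ` ?Z)" by (rule subset_antisym)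
  next
    fix r :: "(nat + nat) \<times> (nat + nat)" and w :: "nat + nat \<Rightarrow> 'a"
    assume r: "r \<in> ?I" and w: "w \<in> ?Z"
    define S where "S = (\<lambda>i. w (Inl i)) ` hverts F"
    have S: "S \<in> \<T>" using w by (simp add: S_def tile_code_def)
    have code: "half_edge_graph_iso (\<lambda>i. w (Inl i)) (\<lambda>h. (w (Inl (incid F h)), w (Inr h))) F (half_nbhd G S)"
      unfolding S_def using w iso[OF S] by (intro tile_code_iso[OF fin, of G \<T>]) (auto simp: S_def)
    from r consider (edge) i j where "(i, j) \<in> hedges F" "r = (Inl i, Inl j)"
      | (half) h where "h \<in> halfs F" "r = (Inl (incid F h), Inr h)" by auto
    then show "f ((case r of (p, q) \<Rightarrow> \<lambda>w. (w p, w q)) w) =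
        (case r of (p, q) \<Rightarrow> case q of Inl j \<Rightarrow> E (projl p) j | Inr _ \<Rightarrow> c)"
    proof cases
      case edge
      then have "f (w (Inl i), w (Inl j)) = E (\<phi> S (w (Inl i))) (\<phi> S (w (Inl j)))"
        using EV by (intro f_in S) (auto simp: S_def)
      \<comment> \<open>The code followed by \<open>\<phi> S\<close> is an automorphism of
        \<open>F\<close>, in general not the identity; invariance of \<open>E\<close> absorbs
        it.\<close>
      also have "\<dots> = E i j"
        using EV edge(1) by (intro E(4)[OF half_edge_graph_iso_trans[OF F code \<phi>[OF S]]])
      finally show ?thesis using edge by simp
    next
      case half
      have "w (Inr h) \<notin> S" using w half(1) by (auto simp: S_def tile_code_def)
      then have "f (w (Inl (incid F h)), w (Inr h)) = c"
        using IV[OF half(1)] by (intro f_out[OF S]) (auto simp: S_def)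
      then show ?thesis using half by simp
    qed
  qed
  then have "borel_fractional_perfect_matching M G f"
    unfolding borel_fractional_perfect_matching_def
    using f_nonneg f_le_one f_sum f_sym by auto
  then show ?thesis by blast
qed

end
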